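(* Let $n\ge1$ and $\alpha\in2\mathbf Z_{>0}$, put $y=nb_3+\tfrac{n\alpha}{2}b_{-3}$, and let $f$ be a holomorphic modular form on $\mathfrak h'_y$ of weight $\ell>0$ and level $M'(\mathbf Z)$ with Fourier expansion $f(Z)=\sum_{S\in V'_{1,2}(\mathbf Z)^\vee_{\ge0}}A[S]e^{2\pi i(S,Z)}$. Suppose $A[S]=0$ for all $S\in V'_{1,2}(\mathbf Z)^\vee$ with $\mathbf Q\text{-span}\{S\}\cap V'_{1,2}(\mathbf Z)^\vee=\mathbf Z\text{-span}\{S\}$. Then $f\equiv0$.
   Context: Let $V$ be the split $8$-dimensional rational quadratic space with bilinear form $(\cdot,\cdot)$ and isotropic basis $b_{\pm1},\dots,b_{\pm4}$, $(b_{\pm i},b_{\pm j})=0$, $(b_{\pm i},b_{\mp j})=\delta_{ij}$; $G=\mathrm{Spin}(V)$ and $G(\widehat{\mathbf Z})$ the $\widehat{\mathbf Z}$-points of its Chevalley model given by the $\mathbf Z$-span of this basis. Let $V_{3,3}$ be the orthogonal complement of $\mathrm{span}\{b_1,b_{-1}\}$ and $M'=\mathrm{Stab}_{\mathrm{Spin}(V_{3,3})}(y)\simeq\mathrm{Spin}(V'_{2,3})$ where $V'_{2,3}=y^\perp\cap V_{3,3}=\mathrm{span}\{b_2,b_4,y^\vee_\alpha,b_{-4},b_{-2}\}$ with $y_\alpha^\vee=b_3-\tfrac\alpha2b_{-3}$; $M'$ acts on $V'_{2,3}$ through $\mathrm{SO}(V'_{2,3})$. Let $M'(\mathbf Z)=M'(\mathbf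 Q)\cap G(\widehat{\mathbf Z})$. Let $V'_{1,2}=\mathrm{span}\{b_4,y_\alpha^\vee,b_{-4}\}$, $V'_{1,2}(\mathbf Z)$ its $\mathbf Z$-span, $V'_{1,2}(\mathbf Z)^\vee=\mathbf Z\text{-span}\{b_4,\tfrac1\alpha y_\alpha^\vee,b_{-4}\}$, $v_2=(b_4+b_{-4})/\sqrt2$, and $V'_{1,2}(\mathbf Z)^\vee_{\ge0}=\{S: (S,S)\ge0,(S,-\sqrt2v_2)\ge0\}$. The domain is $\mathfrak h'_y=\{X+iY\in V'_{1,2}\otimes\mathbf C:(Y,-\sqrt2v_2)>0,(Y,Y)>0\}$; in coordinates $Z=-\tau'b_4+zy_\alpha^\vee-\tau b_{-4}$ it is $\{\mathrm{Im}\tau>0,\mathrm{Im}\tau'>0,\mathrm{Im}\tau\,\mathrm{Im}\tau'-\tfrac\alpha2(\mathrm{Im}z)^2>0\}$. With $r(Z)=-q(Z)b_2+Z+b_{-2}$, $g\in M'(\mathbf R)$ acts by $g\,r(Z)=j_y(g,Z)\,r(gZ)$, $j_y(g,Z)=(g\,r(Z),b_2)$. A holomorphic modular form of weight $\ell$ and level $\Gamma$ is a holomorphic $f:\mathfrak h'_y\to\mathbf C$ with $f(\gamma Z)=j_y(\gamma,Z)^\ell f(Z)$ for $\gamma\in\Gamma$ and with $g\mapsto j_y(g,-i\sqrt2v_2)^{-\ell}f(g\cdot(-i\sqrt2v_2))$ of moderate growth on $M'(\mathbf R)$; for level $M'(\mathbf Z)$ it has a Fourier expansion of the displayed form, $(S,Z)$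 denoting the complex-bilinear extension of the form. *)

theory Defs
  imports "HOL-Analysis.Analysis" "HOL-Library.Poly_Mapping"
    "HOL-Computational_Algebra.Primes"
begin

section \<open>The split quadratic space\<close>

(* Pi stands for the index i and Ni for the index -i of the basis b_1, ..., b_4, b_-1, ..., b_-4. *)
datatype vidx = P1 | P2 | P3 | P4 | N1 | N2 | N3 | N4

lemma UNIV_vidx: "UNIV = {P1, P2, P3, P4, N1, N2, N3, N4}"
  using vidx.exhaust by blast

instance vidx :: finite
  by standard (simp add: UNIV_vidx)

fun opp :: "vidx \<Rightarrow> vidx" where
  "opp P1 = N1" | "opp P2 = N2" | "opp P3 = N3" | "opp P4 = N4"
| "opp N1 = P1" | "opp N2 = P2" | "opp N3 = P3" | "opp N4 = P4"

definition bvec :: "vidx \<Rightarrow> 'a::{zero,one} ^ vidx" where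
  "bvec i = axis i 1"

text \<open>Used over the reals for \<open>V \<otimes> \<real>\<close> and over the complex numbers for the
  complex-bilinear extension.\<close>
definition bf :: "'a::comm_ring_1 ^ vidx \<Rightarrow> 'a ^ vidx \<Rightarrow> 'a" where
  "bf v w = (\<Sum>i\<in>UNIV. v $ i * w $ opp i)"

definition qf :: "'a::field ^ vidx \<Rightarrow> 'a" where
  "qf v = bf v v / 2"

section \<open>The Clifford algebra\<close>

subsection \<open>The tensor algebra\<close>

text \<open>The tensor algebra of \<open>V \<otimes> \<real>\<close> is the monoid algebra of the free monoid on the indices of the
  basis; a wrapper around lists avoids a global instance for the list type.\<close>
datatype tword = W (letters: "vidx list")

instantiation tword :: monoid_add
begin
definition "0 = W []"
definition "x + y = W (letters x @ letters y)"
instance by standard (simp_all add: zero_tword_def plus_tword_def)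
end

type_synonym tensor = "tword \<Rightarrow>\<^sub>0 real"

abbreviation tmono :: "tword \<Rightarrow> real \<Rightarrow> tensor" where
  "tmono \<equiv> Poly_Mapping.single"

definition tvec :: "real ^ vidx \<Rightarrow> tensor" where
  "tvec v = (\<Sum>i\<in>UNIV. tmono (W [i]) (v $ i))"

text \<open>The two-sided ideal generated by the elements \<open>v \<otimes> v - q(v)\<close>.\<close>
inductive_set clifford_ideal :: "tensor set" where
  zero: "0 \<in> clifford_ideal"
| gen: "a * (tvec v * tvec v - tmono 0 (qf v)) * b \<in> clifford_ideal"
| add: "x \<in> clifford_ideal \<Longrightarrow> y \<in> clifford_ideal \<Longrightarrow> x + y \<in> clifford_ideal"

lemma clifford_ideal_mult_left: "x \<in> clifford_ideal \<Longrightarrow> c * x \<in> clifford_ideal"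
proof (induction rule: clifford_ideal.induct)
  case (gen a v b)
  show ?case using clifford_ideal.gen[of "c * a" v b] by (simp add: mult.assoc)
qed (auto simp: distrib_left intro: clifford_ideal.intros)

lemma clifford_ideal_mult_right: "x \<in> clifford_ideal \<Longrightarrow> x * c \<in> clifford_ideal"
proof (induction rule: clifford_ideal.induct)
  case (gen a v b)
  show ?case using clifford_ideal.gen[of a v "b * c"] by (simp add: mult.assoc)
qed (auto simp: distrib_right intro: clifford_ideal.intros)

lemma clifford_ideal_uminus: "x \<in> clifford_ideal \<Longrightarrow> - x \<in> clifford_ideal"
  using clifford_ideal_mult_left[of x "-1"] by simp

lemma tensor_induct [case_names zero mono add]:
  fixes x :: tensor
  assumes "P 0" "\<And>w c. P (tmono w c)" "\<And>x y. P x \<Longrightarrow> P y \<Longrightarrow> P (x + y)"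
  shows "P x"
proof (induction x rule: Poly_Mapping.update_induct)
  case const
  show ?case by (rule assms(1))
next
  case (update p w c)
  have "Poly_Mapping.update w c p = p + tmono w c"
    using update(1)
    by (intro poly_mapping_eqI)
       (auto simp: lookup_update lookup_add lookup_single when_def in_keys_iff)
  then show ?case using update assms by metis
qed

lemma tmono_0_central: "tmono 0 r * x = x * tmono 0 r"
  by (induction x rule: tensor_induct) (simp_all add: mult_single mult.commute algebra_simps)

subsection \<open>The ideal is proper\<close>

text \<open>The algebra acts by creation and annihilation operators on the functions on subsets of a
  four-element set, each subset given by four booleans.\<close>

type_synonym spinor = "bool \<times> bool \<times> bool \<times> bool \<Rightarrow> real"

definition psgn :: "bool \<Rightarrow> real" where
  "psgn a = (if a then - 1 else 1)"

fun gen_op :: "vidx \<Rightarrow> spinor \<Rightarrow> spinor" where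
  "gen_op P1 u = (\<lambda>(a,b,c,d). if a then u (False,b,c,d) else 0)"
| "gen_op N1 u = (\<lambda>(a,b,c,d). if a then 0 else u (True,b,c,d))"
| "gen_op P2 u = (\<lambda>(a,b,c,d). psgn a * (if b then u (a,False,c,d) else 0))"
| "gen_op N2 u = (\<lambda>(a,b,c,d). psgn a * (if b then 0 else u (a,True,c,d)))"
| "gen_op P3 u = (\<lambda>(a,b,c,d). psgn a * psgn b * (if c then u (a,b,False,d) else 0))"
| "gen_op N3 u = (\<lambda>(a,b,c,d). psgn a * psgn b * (if c then 0 else u (a,b,True,d)))"
| "gen_op P4 u = (\<lambda>(a,b,c,d). psgn a * psgn b * psgn c * (if d then u (a,b,c,False) else 0))"
| "gen_op N4 u = (\<lambda>(a,b,c,d). psgn a * psgn b * psgn c * (if d then 0 else u (a,b,c,True)))"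

definition word_op :: "tword \<Rightarrow> spinor \<Rightarrow> spinor" where
  "word_op w u = foldr gen_op (letters w) u"

definition tensor_op :: "tensor \<Rightarrow> spinor \<Rightarrow> spinor" where
  "tensor_op x u s = (\<Sum>w\<in>Poly_Mapping.keys x. Poly_Mapping.lookup x w * word_op w u s)"

lemma tensor_op_superset:
  assumes "finite A" "Poly_Mapping.keys x \<subseteq> A"
  shows "tensor_op x u s = (\<Sum>w\<in>A. Poly_Mapping.lookup x w * word_op w u s)"
  unfolding tensor_op_def
  by (rule sum.mono_neutral_left) (use assms in \<open>auto simp: in_keys_iff\<close>)

lemma tensor_op_add: "tensor_op (x + y) u = (\<lambda>s. tensor_op x u s + tensor_op y u s)"
proof
  fix s
  let ?A = "Poly_Mapping.keys x \<union> Poly_Mapping.keys y"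
  have "Poly_Mapping.keys (x + y) \<subseteq> ?A" by (rule Poly_Mapping.keys_add)
  then show "tensor_op (x + y) u s = tensor_op x u s + tensor_op y u s"
    by (simp add: tensor_op_superset[where A = ?A] lookup_add distrib_right sum.distrib)
qed

lemma tensor_op_0: "tensor_op 0 u = (\<lambda>s. 0)"
  by (auto simp: tensor_op_def)

lemma tensor_op_mono: "tensor_op (tmono w c) u = (\<lambda>s. c * word_op w u s)"
  by (rule ext, cases "c = 0") (simp_all add: tensor_op_def)

lemma gen_op_add: "gen_op i (\<lambda>s. u s + v s) = (\<lambda>s. gen_op i u s + gen_op i v s)"
  by (cases i) (auto simp: algebra_simps fun_eq_iff)

lemma gen_op_scale: "gen_op i (\<lambda>s. c * u s) = (\<lambda>s. c * gen_op i u s)"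
  by (cases i) (auto simp: algebra_simps fun_eq_iff)

lemma foldr_gen_op_add:
  "foldr gen_op xs (\<lambda>s. u s + v s) = (\<lambda>s. foldr gen_op xs u s + foldr gen_op xs v s)"
  by (induction xs) (simp_all add: gen_op_add)

lemma foldr_gen_op_scale:
  "foldr gen_op xs (\<lambda>s. c * u s) = (\<lambda>s. c * foldr gen_op xs u s)"
  by (induction xs) (simp_all add: gen_op_scale)

lemma tensor_op_linear:
  "tensor_op x (\<lambda>s. u s + v s) = (\<lambda>s. tensor_op x u s + tensor_op x v s)"
  "tensor_op x (\<lambda>s. c * u s) = (\<lambda>s. c * tensor_op x u s)"
  by (auto simp: tensor_op_def word_op_def foldr_gen_op_add foldr_gen_op_scale distrib_left
      sum.distrib sum_distrib_left mult.left_commute)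

lemma tensor_op_mult: "tensor_op (x * y) u = tensor_op x (tensor_op y u)"
proof (induction x rule: tensor_induct)
  case (mono w c)
  show ?case
  proof (induction y rule: tensor_induct)
    case zero
    show ?case using tensor_op_linear(2)[of "tmono w c" 0 "\<lambda>s. 0"]
      by (simp add: tensor_op_0)
  next
    case (mono w' c')
    show ?case
      by (simp add: mult_single tensor_op_mono word_op_def plus_tword_def foldr_gen_op_scale
          mult.assoc)
  next
    case (add x y)
    then show ?case by (simp add: distrib_left tensor_op_add tensor_op_linear)
  qed
next
  case (add x y)
  then show ?case by (simp add: distrib_right tensor_op_add)
qed (simp add: tensor_op_0)

lemma tvec_expand:
  "tvec v = tmono (W [P1]) (v $ P1) + tmono (W [P2]) (v $ P2) + tmono (W [P3]) (v $ P3)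
    + tmono (W [P4]) (v $ P4) + tmono (W [N1]) (v $ N1) + tmono (W [N2]) (v $ N2)
    + tmono (W [N3]) (v $ N3) + tmono (W [N4]) (v $ N4)"
  by (simp add: tvec_def UNIV_vidx add.assoc)

lemma qf_expand:
  "qf (v :: 'a::field_char_0 ^ vidx) = v $ P1 * v $ N1 + v $ P2 * v $ N2 + v $ P3 * v $ N3 + v $ P4 * v $ N4"
  by (simp add: qf_def bf_def UNIV_vidx field_simps)

lemma tensor_op_tvec_square: "tensor_op (tvec v) (tensor_op (tvec v) u) = (\<lambda>s. qf v * u s)"
proof
  fix s :: "bool \<times> bool \<times> bool \<times> bool"
  obtain a b c d where s: "s = (a, b, c, d)" by (cases s)
  have *: "tensor_op (tvec v) u = (\<lambda>s. v $ P1 * gen_op P1 u s + v $ P2 * gen_op P2 u s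
      + v $ P3 * gen_op P3 u s + v $ P4 * gen_op P4 u s + v $ N1 * gen_op N1 u s
      + v $ N2 * gen_op N2 u s + v $ N3 * gen_op N3 u s + v $ N4 * gen_op N4 u s)" for u
    by (simp add: tvec_expand tensor_op_add tensor_op_mono word_op_def)
  show "tensor_op (tvec v) (tensor_op (tvec v) u) s = qf v * u s"
    unfolding * s qf_expand
    by (cases a; cases b; cases c; cases d) (simp_all add: psgn_def algebra_simps)
qed

lemma tensor_op_ideal: "x \<in> clifford_ideal \<Longrightarrow> tensor_op x u = (\<lambda>s. 0)"
proof (induction arbitrary: u rule: clifford_ideal.induct)
  case (gen a v b)
  have uminus: "tensor_op (- x) u = (\<lambda>s. - tensor_op x u s)" for x u
    using tensor_op_add[of x "- x" u] by (auto simp: tensor_op_0 fun_eq_iff add_eq_0_iff)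
  have *: "tensor_op (tvec v * tvec v - tmono 0 (qf v)) u = (\<lambda>s. 0)" for u
    unfolding diff_conv_add_uminus
    by (simp only: tensor_op_add uminus) (simp add: tensor_op_mult tensor_op_tvec_square tensor_op_mono
        word_op_def zero_tword_def)
  show ?case
    using tensor_op_linear(2)[of a 0 "\<lambda>s. 0"] by (simp add: tensor_op_mult *)
qed (simp_all add: tensor_op_0 tensor_op_add)

lemma one_notin_clifford_ideal: "1 \<notin> clifford_ideal"
proof
  assume "1 \<in> clifford_ideal"
  from tensor_op_ideal[OF this, of "\<lambda>s. 1"]
  have "tensor_op (tmono 0 1) (\<lambda>s. 1) = (\<lambda>s. 0)" by simp
  then show False by (simp add: tensor_op_mono word_op_def zero_tword_def fun_eq_iff)
qed

subsection \<open>The quotient\<close>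

definition clifford_rel :: "tensor \<Rightarrow> tensor \<Rightarrow> bool" where
  "clifford_rel x y \<longleftrightarrow> x - y \<in> clifford_ideal"

lemma equivp_clifford_rel: "equivp clifford_rel"
proof (rule equivpI)
  show "reflp clifford_rel"
    by (auto simp: reflp_def clifford_rel_def intro: clifford_ideal.zero)
  show "symp clifford_rel"
    unfolding symp_def clifford_rel_def using clifford_ideal_uminus by fastforce
  show "transp clifford_rel"
    unfolding transp_def clifford_rel_def using clifford_ideal.add by fastforce
qed

quotient_type clifford = tensor / clifford_rel
  by (rule equivp_clifford_rel)

instantiation clifford :: ring_1
begin

lift_definition zero_clifford :: clifford is 0 .
lift_definition one_clifford :: clifford is 1 .
lift_definition plus_clifford :: "clifford \<Rightarrow> clifford \<Rightarrow> clifford" is "(+)"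
  unfolding clifford_rel_def using clifford_ideal.add by (fastforce simp: algebra_simps)
lift_definition uminus_clifford :: "clifford \<Rightarrow> clifford" is uminus
  unfolding clifford_rel_def using clifford_ideal_uminus by fastforce
lift_definition minus_clifford :: "clifford \<Rightarrow> clifford \<Rightarrow> clifford" is "(-)"
proof -
  fix a b c d assume "clifford_rel a b" "clifford_rel c d"
  then have "(a - b) + - (c - d) \<in> clifford_ideal"
    unfolding clifford_rel_def by (intro clifford_ideal.add clifford_ideal_uminus)
  then show "clifford_rel (a - c) (b - d)"
    unfolding clifford_rel_def by (simp add: algebra_simps)
qed
lift_definition times_clifford :: "clifford \<Rightarrow> clifford \<Rightarrow> clifford" is "(*)"
proof -
  fix a b c d assume "clifford_rel a b" "clifford_rel c d"
  then have "(a - b) * c + b * (c - d) \<in> clifford_ideal"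
    unfolding clifford_rel_def
    by (intro clifford_ideal.add clifford_ideal_mult_left clifford_ideal_mult_right)
  then show "clifford_rel (a * c) (b * d)"
    unfolding clifford_rel_def by (simp add: algebra_simps)
qed

instance
proof
  show "(0 :: clifford) \<noteq> 1"
  proof transfer
    show "\<not> clifford_rel 0 1"
      using one_notin_clifford_ideal clifford_ideal_uminus[of "- 1"]
      by (auto simp: clifford_rel_def)
  qed
qed (transfer; simp add: clifford_rel_def clifford_ideal.zero algebra_simps)+

end

instantiation clifford :: real_algebra_1
begin

lift_definition scaleR_clifford :: "real \<Rightarrow> clifford \<Rightarrow> clifford" is "\<lambda>r x. tmono 0 r * x"
  unfolding clifford_rel_def
  using clifford_ideal_mult_left by (fastforce simp: right_diff_distrib[symmetric])

instance
proof
  fix a b :: real and x y :: clifford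
  show "a *\<^sub>R (x + y) = a *\<^sub>R x + a *\<^sub>R y"
    by transfer (simp add: clifford_rel_def clifford_ideal.zero algebra_simps)
  show "(a + b) *\<^sub>R x = a *\<^sub>R x + b *\<^sub>R x"
    by transfer (simp add: clifford_rel_def clifford_ideal.zero algebra_simps single_add)
  show "a *\<^sub>R b *\<^sub>R x = (a * b) *\<^sub>R x"
    by transfer (simp add: clifford_rel_def clifford_ideal.zero mult_single mult.assoc[symmetric])
  show "1 *\<^sub>R x = x"
    by transfer (simp add: clifford_rel_def clifford_ideal.zero)
  show "a *\<^sub>R x * y = a *\<^sub>R (x * y)"
    by transfer (simp add: clifford_rel_def clifford_ideal.zero mult.assoc)
  show "x * a *\<^sub>R y = a *\<^sub>R (x * y)"
    by transfer (simp add: clifford_rel_def clifford_ideal.zero mult.assoc[symmetric]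
        flip: tmono_0_central)
qed

end

lift_definition cl_vec :: "real ^ vidx \<Rightarrow> clifford" is tvec .

lemma cl_vec_square: "cl_vec v * cl_vec v = qf v *\<^sub>R 1"
  using clifford_ideal.gen[of 1 v 1] by transfer (simp add: clifford_rel_def)

lemma cl_vec_add: "cl_vec (v + w) = cl_vec v + cl_vec w"
  by transfer (simp add: clifford_rel_def clifford_ideal.zero tvec_def single_add sum.distrib)

lemma cl_vec_scaleR: "cl_vec (c *\<^sub>R v) = c *\<^sub>R cl_vec v"
  by transfer
     (simp add: clifford_rel_def clifford_ideal.zero tvec_def sum_distrib_left mult_single)

lemma bf_add: "bf (u + v) w = bf u w + bf v w" "bf w (u + v) = bf w u + bf w v"
  by (simp_all add: bf_def algebra_simps sum.distrib)

lemma bf_sym: "bf v w = bf w v"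
  by (simp add: bf_def UNIV_vidx algebra_simps)

lemma cl_vec_anticomm: "cl_vec v * cl_vec w + cl_vec w * cl_vec v = bf v w *\<^sub>R 1"
proof -
  have "qf (v + w) *\<^sub>R (1::clifford) = (qf v + qf w + bf v w) *\<^sub>R 1"
    using bf_sym[of w v] by (simp add: qf_def bf_add field_simps)
  then show ?thesis
    using cl_vec_square[of "v + w"]
    by (simp add: cl_vec_add distrib_left distrib_right cl_vec_square scaleR_left_distrib
        algebra_simps)
qed

lemma inj_cl_vec: "inj cl_vec"
proof (rule injI)
  fix v w assume eq: "cl_vec v = cl_vec w"
  have "v $ i = w $ i" for i
  proof -
    have "bf v (bvec (opp i)) *\<^sub>R (1::clifford) = bf w (bvec (opp i)) *\<^sub>R 1"
      by (simp only: cl_vec_anticomm[symmetric] eq)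
    then have "bf v (bvec (opp i)) = bf w (bvec (opp i))" by simp
    then show ?thesis
      by (cases i) (simp_all add: bf_def bvec_def UNIV_vidx axis_def)
  qed
  then show "v = w" by (simp add: vec_eq_iff)
qed

subsection \<open>The main anti-involution\<close>

definition word_rev :: "tword \<Rightarrow> tword" where
  "word_rev w = W (rev (letters w))"

lemma word_rev_simps [simp]: "word_rev (word_rev w) = w"
  "word_rev (v + w) = word_rev w + word_rev v" "word_rev 0 = 0" "word_rev (W [i]) = W [i]"
  by (simp_all add: word_rev_def plus_tword_def zero_tword_def)

lemma inj_word_rev [simp]: "inj word_rev"
  by (metis injI word_rev_simps(1))

definition tensor_rev :: "tensor \<Rightarrow> tensor" where
  "tensor_rev = Poly_Mapping.map_key word_rev"

lemma tensor_rev_add: "tensor_rev (x + y) = tensor_rev x + tensor_rev y"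
  by (simp add: tensor_rev_def map_key_plus)

lemma tensor_rev_0 [simp]: "tensor_rev 0 = 0"
  by (simp add: tensor_rev_def map_key_zero)

lemma tensor_rev_mono [simp]: "tensor_rev (tmono w c) = tmono (word_rev w) c"
  using map_key_single[OF inj_word_rev, of "word_rev w" c] by (simp add: tensor_rev_def)

lemma tensor_rev_uminus: "tensor_rev (- x) = - tensor_rev x"
  using tensor_rev_add[of x "- x"] by (simp add: eq_neg_iff_add_eq_0 add.commute)

lemma tensor_rev_diff: "tensor_rev (x - y) = tensor_rev x - tensor_rev y"
  unfolding diff_conv_add_uminus by (simp only: tensor_rev_add tensor_rev_uminus)

lemma tensor_rev_mult: "tensor_rev (x * y) = tensor_rev y * tensor_rev x"
proof (induction x rule: tensor_induct)
  case (mono w c)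
  show ?case
    by (induction y rule: tensor_induct)
       (simp_all add: mult_single mult.commute tensor_rev_add distrib_left distrib_right)
qed (simp_all add: tensor_rev_add distrib_left distrib_right)

lemma tensor_rev_tvec: "tensor_rev (tvec v) = tvec v"
  by (simp add: tvec_expand tensor_rev_add)

lemma tensor_rev_ideal: "x \<in> clifford_ideal \<Longrightarrow> tensor_rev x \<in> clifford_ideal"
proof (induction rule: clifford_ideal.induct)
  case (gen a v b)
  show ?case
    using clifford_ideal.gen[of "tensor_rev b" v "tensor_rev a"]
    by (simp add: tensor_rev_mult tensor_rev_diff tensor_rev_tvec mult.assoc)
qed (auto simp: tensor_rev_add intro: clifford_ideal.intros)

text \<open>The anti-automorphism that is the identity on \<open>V\<close>.\<close>
lift_definition cl_rev :: "clifford \<Rightarrow> clifford" is tensor_rev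
  unfolding clifford_rel_def using tensor_rev_ideal by (fastforce simp: tensor_rev_diff)

lemma cl_rev_mult: "cl_rev (x * y) = cl_rev y * cl_rev x"
  by transfer (simp add: clifford_rel_def clifford_ideal.zero tensor_rev_mult)

lemma cl_rev_add: "cl_rev (x + y) = cl_rev x + cl_rev y"
  by transfer (simp add: clifford_rel_def clifford_ideal.zero tensor_rev_add)

lemma cl_rev_scaleR: "cl_rev (r *\<^sub>R x) = r *\<^sub>R cl_rev x"
  by transfer (simp add: clifford_rel_def clifford_ideal.zero tensor_rev_mult tmono_0_central)

lemma cl_rev_vec: "cl_rev (cl_vec v) = cl_vec v"
  by transfer (simp add: clifford_rel_def clifford_ideal.zero tensor_rev_tvec)

lemma cl_rev_one: "cl_rev 1 = 1"
  using cl_rev_mult[of 1 "cl_rev 1"]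
  by transfer (simp add: clifford_rel_def clifford_ideal.zero flip: single_one)

section \<open>Spin groups\<close>

text \<open>In the following \<open>R\<close> is a subring of the reals and \<open>I\<close> a set of indices stable under \<open>opp\<close>.
  Then \<open>vlattice I R\<close> is the free \<open>R\<close>-module on the corresponding basis vectors, and
  \<open>even_clifford I R\<close> is the even part of its Clifford algebra over \<open>R\<close>.\<close>

definition vlattice :: "vidx set \<Rightarrow> real set \<Rightarrow> (real ^ vidx) set" where
  "vlattice I R = {v. (\<forall>i\<in>I. v $ i \<in> R) \<and> (\<forall>i. i \<notin> I \<longrightarrow> v $ i = 0)}"

inductive_set even_clifford :: "vidx set \<Rightarrow> real set \<Rightarrow> clifford set"
  for I :: "vidx set" and R :: "real set" where
  monomial: "r \<in> R \<Longrightarrow> set is \<subseteq> I \<Longrightarrow> even (length is)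
    \<Longrightarrow> r *\<^sub>R prod_list (map (\<lambda>i. cl_vec (bvec i)) is) \<in> even_clifford I R"
| add: "x \<in> even_clifford I R \<Longrightarrow> y \<in> even_clifford I R \<Longrightarrow> x + y \<in> even_clifford I R"

text \<open>The \<open>R\<close>-points of the spin group scheme of \<open>vlattice I \<int>\<close>.  Its inclusion into the even Clifford
  algebra being a closed immersion, these are the real points with coordinates in \<open>R\<close>.\<close>
definition spin_group :: "vidx set \<Rightarrow> real set \<Rightarrow> clifford set" where
  "spin_group I R = {g \<in> even_clifford I R. g * cl_rev g = 1 \<and> cl_rev g * g = 1 \<and>
     (\<lambda>x. g * x * cl_rev g) ` cl_vec ` vlattice I R = cl_vec ` vlattice I R}"

definition spin_act :: "clifford \<Rightarrow> real ^ vidx \<Rightarrow> real ^ vidx" where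
  "spin_act g v = (THE w. cl_vec w = g * cl_vec v * cl_rev g)"

text \<open>The indices of the basis of \<open>V\<^sub>3\<^sub>,\<^sub>3\<close>.\<close>
definition I33 :: "vidx set" where
  "I33 = - {P1, N1}"

definition y_vec :: "nat \<Rightarrow> nat \<Rightarrow> real ^ vidx" where
  "y_vec n \<alpha> = real n *\<^sub>R bvec P3 + (real n * real \<alpha> / 2) *\<^sub>R bvec N3"

text \<open>\<open>M'(R)\<close>, for a subring \<open>R\<close> of the reals that is a field.\<close>
definition Mprime :: "nat \<Rightarrow> nat \<Rightarrow> real set \<Rightarrow> clifford set" where
  "Mprime n \<alpha> R = {g \<in> spin_group I33 R. spin_act g (y_vec n \<alpha>) = y_vec n \<alpha>}"

text \<open>\<open>\<rat> \<inter> \<int>\<^sub>p\<close>\<close>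
definition Z_local :: "nat \<Rightarrow> real set" where
  "Z_local p = {of_int a / of_int b | a b :: int. \<not> int p dvd b}"

text \<open>The group of points of \<open>G\<close> over the profinite integers is the product of the groups
  \<open>G(\<int>\<^sub>p)\<close>, so a rational point of \<open>G\<close> lies in it iff it lies
  in every \<open>G(\<rat> \<inter> \<int>\<^sub>p)\<close>.\<close>
definition MprimeZ :: "nat \<Rightarrow> nat \<Rightarrow> clifford set" where
  "MprimeZ n \<alpha> = Mprime n \<alpha> \<rat> \<inter> (\<Inter>p\<in>{p. prime p}. spin_group UNIV (Z_local p))"

section \<open>The symmetric domain\<close>

definition y_dual :: "nat \<Rightarrow> real ^ vidx" where
  "y_dual \<alpha> = bvec P3 - (real \<alpha> / 2) *\<^sub>R bvec N3"

definition V12 :: "nat \<Rightarrow> (real ^ vidx) set" where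
  "V12 \<alpha> = span {bvec P4, y_dual \<alpha>, bvec N4}"

definition v2 :: "real ^ vidx" where
  "v2 = (1 / sqrt 2) *\<^sub>R (bvec P4 + bvec N4)"

text \<open>\<open>V'\<^sub>1\<^sub>,\<^sub>2(\<int>)\<^sup>\<or>\<close>\<close>
definition V12_dual :: "nat \<Rightarrow> (real ^ vidx) set" where
  "V12_dual \<alpha> = {of_int a *\<^sub>R bvec P4 + of_int b *\<^sub>R ((1 / real \<alpha>) *\<^sub>R y_dual \<alpha>)
      + of_int c *\<^sub>R bvec N4 | a b c :: int. True}"

definition V12_dual_nonneg :: "nat \<Rightarrow> (real ^ vidx) set" where
  "V12_dual_nonneg \<alpha> = {S \<in> V12_dual \<alpha>. bf S S \<ge> 0 \<and> bf S (- sqrt 2 *\<^sub>R v2) \<ge> 0}"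

definition cvec :: "real ^ vidx \<Rightarrow> complex ^ vidx" where
  "cvec v = (\<chi> i. complex_of_real (v $ i))"

definition mk_cvec :: "real ^ vidx \<Rightarrow> real ^ vidx \<Rightarrow> complex ^ vidx" where
  "mk_cvec X Y = cvec X + \<i> *s cvec Y"

definition V12_complex :: "nat \<Rightarrow> (complex ^ vidx) set" where
  "V12_complex \<alpha> = {mk_cvec X Y | X Y. X \<in> V12 \<alpha> \<and> Y \<in> V12 \<alpha>}"

definition hdom :: "nat \<Rightarrow> (complex ^ vidx) set" where
  "hdom \<alpha> = {mk_cvec X Y | X Y. X \<in> V12 \<alpha> \<and> Y \<in> V12 \<alpha> \<and>
      bf Y (- sqrt 2 *\<^sub>R v2) > 0 \<and> bf Y Y > 0}"

definition r_vec :: "complex ^ vidx \<Rightarrow> complex ^ vidx" where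
  "r_vec Z = - qf Z *s bvec P2 + Z + bvec N2"

definition spin_act_c :: "clifford \<Rightarrow> complex ^ vidx \<Rightarrow> complex ^ vidx" where
  "spin_act_c g Z = mk_cvec (spin_act g (\<chi> i. Re (Z $ i))) (spin_act g (\<chi> i. Im (Z $ i)))"

definition j_fac :: "clifford \<Rightarrow> complex ^ vidx \<Rightarrow> complex" where
  "j_fac g Z = bf (spin_act_c g (r_vec Z)) (bvec P2)"

definition dom_act :: "nat \<Rightarrow> clifford \<Rightarrow> complex ^ vidx \<Rightarrow> complex ^ vidx" where
  "dom_act \<alpha> g Z = (THE Z'. Z' \<in> V12_complex \<alpha> \<and>
      spin_act_c g (r_vec Z) = j_fac g Z *s r_vec Z')"

definition base_pt :: "complex ^ vidx" where
  "base_pt = (- \<i> * complex_of_real (sqrt 2)) *s cvec v2"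

section \<open>Holomorphic modular forms\<close>

text \<open>The domain is open in the three-dimensional subspace \<open>V12_complex \<alpha>\<close> of the ambient space.
  Only the restriction of the derivative \<open>D\<close> to this subspace is determined, and every complex
  linear map on the subspace extends, so this is holomorphy on the domain.\<close>
definition holo_on_dom :: "nat \<Rightarrow> (complex ^ vidx \<Rightarrow> complex) \<Rightarrow> bool" where
  "holo_on_dom \<alpha> f \<longleftrightarrow> (\<forall>Z\<in>hdom \<alpha>. \<exists>D. (\<forall>c v. D (c *s v) = c * D v) \<and>
      (f has_derivative D) (at Z within hdom \<alpha>))"

text \<open>The Hilbert-Schmidt norm of \<open>g\<close> on \<open>V \<otimes> \<real>\<close>, a representation with finite kernel and closed
  image, as a norm on the real group.\<close>
definition spin_norm :: "clifford \<Rightarrow> real" where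
  "spin_norm g = sqrt (\<Sum>k\<in>UNIV. \<Sum>i\<in>UNIV. (spin_act g (bvec k) $ i)\<^sup>2)"

definition moderate_growth :: "clifford set \<Rightarrow> (clifford \<Rightarrow> complex) \<Rightarrow> bool" where
  "moderate_growth G \<phi> \<longleftrightarrow> (\<exists>C (N::nat). \<forall>g\<in>G. cmod (\<phi> g) \<le> C * spin_norm g ^ N)"

definition holo_modular_form ::
  "nat \<Rightarrow> nat \<Rightarrow> nat \<Rightarrow> clifford set \<Rightarrow> (complex ^ vidx \<Rightarrow> complex) \<Rightarrow> bool" where
  "holo_modular_form n \<alpha> l \<Gamma> f \<longleftrightarrow> holo_on_dom \<alpha> f \<and>
     (\<forall>\<gamma>\<in>\<Gamma>. \<forall>Z\<in>hdom \<alpha>. f (dom_act \<alpha> \<gamma> Z) = j_fac \<gamma> Z ^ l * f Z) \<and>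
     moderate_growth (Mprime n \<alpha> \<real>) (\<lambda>g. inverse (j_fac g base_pt ^ l) * f (dom_act \<alpha> g base_pt))"

definition fourier_expansion ::
  "nat \<Rightarrow> (complex ^ vidx \<Rightarrow> complex) \<Rightarrow> (real ^ vidx \<Rightarrow> complex) \<Rightarrow> bool" where
  "fourier_expansion \<alpha> f A \<longleftrightarrow> (\<forall>Z\<in>hdom \<alpha>.
     ((\<lambda>S. A S * exp (2 * of_real pi * \<i> * bf (cvec S) Z)) has_sum f Z) (V12_dual_nonneg \<alpha>))"

end

theory Submission
  imports Defs "HOL-Complex_Analysis.Cauchy_Integral_Formula"
begin

text \<open>In the coordinates \<open>(\<tau>, z, \<tau>')\<close> the form has an expansion in \<open>e(m \<tau> + r z + c \<tau>')\<close> with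
  \<open>r\<^sup>2 \<le> 2 \<alpha> m c\<close>.  Its \<open>c\<close>-th Fourier--Jacobi coefficient is invariant under \<open>SL\<^sub>2(\<int>)\<close>
  acting on \<open>\<tau>\<close>, and for \<open>c > 0\<close> its part with \<open>gcd(m, c) = 1\<close> vanishes by assumption.  This part
  arises by removing, for one prime divisor \<open>p\<close> of \<open>c\<close> after the other, the terms with \<open>p | m\<close>, each
  step keeping invariance under a congruence subgroup of level prime to the remaining primes.  If
  removing the terms with \<open>p | m\<close> leaves \<open>0\<close>, then the form before that step is invariant
  under the translation \<open>\<tau> \<mapsto> \<tau> + 1/p\<close> and under a congruence subgroup of level prime to \<open>p\<close>; these
  generate arbitrarily small translations, so only \<open>m = 0\<close> survives, hence \<open>r = 0\<close>, and
  positive weight forces \<open>0\<close>.  What remains is the term \<open>c = 0\<close>, which depends on \<open>\<tau>\<close> only and is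
  killed by the group acting on \<open>\<tau>'\<close>.\<close>

section \<open>The action of the special linear group\<close>

type_synonym point = "complex \<times> complex \<times> complex"

text \<open>For \<open>N = \<alpha> / 2\<close> this is the domain in the coordinates
  \<open>(\<tau>, z, \<tau>')\<close>. When \<open>N\<close> is nonnegative, the two inequalities
  force \<open>Im \<tau>' > 0\<close>.\<close>

definition siegel_dom :: "real \<Rightarrow> point set" where
  "siegel_dom N = {(\<tau>, z, \<tau>'). Im \<tau> > 0 \<and> Im \<tau> * Im \<tau>' > N * (Im z)\<^sup>2}"

definition aut :: "real \<Rightarrow> real \<Rightarrow> point \<Rightarrow> complex" where
  "aut c d Z = of_real c * fst Z + of_real d"

text \<open>The correction of \<open>\<tau>'\<close> makes
  \<open>Im \<tau> * Im \<tau>' - N * (Im z)\<^sup>2\<close> scale by the inverse square of the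
  modulus of the automorphy factor. The entries are real because translations by fractions occur
  later.\<close>

definition sl_act :: "real \<Rightarrow> real \<Rightarrow> real \<Rightarrow> real \<Rightarrow> real \<Rightarrow> point \<Rightarrow> point" where
  "sl_act N a b c d = (\<lambda>(\<tau>, z, \<tau>'). ((of_real a * \<tau> + of_real b) / (of_real c * \<tau> + of_real d),
     z / (of_real c * \<tau> + of_real d), \<tau>' - of_real N * of_real c * z\<^sup>2 / (of_real c * \<tau> + of_real d)))"

lemma aut_nonzero:
  assumes "Z \<in> siegel_dom N" "a * d - b * c = 1"
  shows "aut c d Z \<noteq> 0"
proof
  assume *: "aut c d Z = 0"
  then have "c * Im (fst Z) = 0" "c * Re (fst Z) + d = 0"
    by (auto simp: aut_def complex_eq_iff)
  moreover have "Im (fst Z) > 0"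
    using assms(1) by (auto simp: siegel_dom_def)
  ultimately show False using assms(2) by auto
qed

lemma Im_moebius:
  assumes "a * d - b * c = 1"
  shows "Im ((of_real a * \<tau> + of_real b) / (of_real c * \<tau> + of_real d))
    = Im \<tau> / (cmod (of_real c * \<tau> + of_real d))\<^sup>2"
proof -
  have "a * Im \<tau> * (c * Re \<tau> + d) - (a * Re \<tau> + b) * (c * Im \<tau>) = (a * d - b * c) * Im \<tau>"
    by (simp add: algebra_simps)
  then show ?thesis
    using assms by (simp add: Im_divide cmod_power2)
qed

text \<open>This keeps the domain stable: multiplied by \<open>N\<close>, it balances the change of
  \<open>Im \<tau>'\<close> against the change of \<open>N * (Im z)\<^sup>2\<close>.\<close>

lemma Im_third_coordinate:
  fixes \<tau> z :: complex and c d :: real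
  defines "j \<equiv> of_real c * \<tau> + of_real d"
  assumes "j \<noteq> 0"
  shows "Im \<tau> * Im (of_real c * z\<^sup>2 / j) + (cmod j)\<^sup>2 * (Im (z / j))\<^sup>2 = (Im z)\<^sup>2"
proof -
  define J where "J = c * Re \<tau> + d"
  define y where "y = c * Im \<tau>"
  have j: "Re j = J" "Im j = y" by (simp_all add: j_def J_def y_def)
  have n: "(cmod j)\<^sup>2 = J\<^sup>2 + y\<^sup>2" using j by (simp add: cmod_power2)
  have pos: "J\<^sup>2 + y\<^sup>2 > 0" using n assms(2) by (metis zero_less_norm_iff zero_less_power)
  have 1: "Im (of_real c * z\<^sup>2 / j) = c * (2 * Re z * Im z * J - ((Re z)\<^sup>2 - (Im z)\<^sup>2) * y) / (J\<^sup>2 + y\<^sup>2)"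
    using j by (simp add: Im_divide power2_eq_square algebra_simps)
  have 2: "Im (z / j) = (Im z * J - Re z * y) / (J\<^sup>2 + y\<^sup>2)"
    using j by (simp add: Im_divide)
  have "Im \<tau> * Im (of_real c * z\<^sup>2 / j) = y * (2 * Re z * Im z * J - ((Re z)\<^sup>2 - (Im z)\<^sup>2) * y) / (J\<^sup>2 + y\<^sup>2)"
    unfolding 1 y_def by simp
  moreover have "(cmod j)\<^sup>2 * (Im (z / j))\<^sup>2 = (Im z * J - Re z * y)\<^sup>2 / (J\<^sup>2 + y\<^sup>2)"
    unfolding n 2 using pos by (simp add: power2_eq_square divide_simps)
  moreover have "y * (2 * Re z * Im z * J - ((Re z)\<^sup>2 - (Im z)\<^sup>2) * y) + (Im z * J - Re z * y)\<^sup>2 = (Im z)\<^sup>2 * (J\<^sup>2 + y\<^sup>2)"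
    by (simp add: power2_eq_square algebra_simps)
  ultimately have "Im \<tau> * Im (of_real c * z\<^sup>2 / j) + (cmod j)\<^sup>2 * (Im (z / j))\<^sup>2
      = (Im z)\<^sup>2 * (J\<^sup>2 + y\<^sup>2) / (J\<^sup>2 + y\<^sup>2)"
    by (simp only: add_divide_distrib[symmetric])
  then show ?thesis using pos by (simp only: nonzero_mult_div_cancel_right less_numeral_extra)
qed

lemma sl_act_dom:
  assumes Z: "Z \<in> siegel_dom N" and det: "a * d - b * c = 1"
  shows "sl_act N a b c d Z \<in> siegel_dom N"
proof -
  obtain \<tau> z \<tau>' where [simp]: "Z = (\<tau>, z, \<tau>')" by (cases Z)
  define j where "j = of_real c * \<tau> + of_real d"
  have j: "j \<noteq> 0" using aut_nonzero[OF assms] by (simp add: aut_def j_def)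
  then have n: "(cmod j)\<^sup>2 > 0" by simp
  have im: "Im ((of_real a * \<tau> + of_real b) / j) = Im \<tau> / (cmod j)\<^sup>2"
    using Im_moebius[OF det] by (simp add: j_def)
  have *: "Im \<tau> > 0" "Im \<tau> * Im \<tau>' > N * (Im z)\<^sup>2" using Z by (auto simp: siegel_dom_def)
  have t: "Im (of_real N * of_real c * z\<^sup>2 / j) = N * Im (of_real c * z\<^sup>2 / j)"
    by (simp add: mult.assoc flip: times_divide_eq_right)
  have eq: "Im \<tau> * Im (of_real c * z\<^sup>2 / j) + (cmod j)\<^sup>2 * (Im (z / j))\<^sup>2 = (Im z)\<^sup>2"
    using Im_third_coordinate[of c \<tau> d z] j by (simp add: j_def)
  have "N * ((cmod j)\<^sup>2 * (Im (z / j))\<^sup>2) < Im \<tau> * (Im \<tau>' - N * Im (of_real c * z\<^sup>2 / j))"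
    using *(2) unfolding eq[symmetric] by (simp add: algebra_simps)
  then have "N * (Im (z / j))\<^sup>2 < Im \<tau> / (cmod j)\<^sup>2 * (Im \<tau>' - N * Im (of_real c * z\<^sup>2 / j))"
    using n by (simp add: field_simps)
  then show ?thesis
    using im t * n by (simp add: sl_act_def siegel_dom_def flip: j_def)
qed

lemma aut_mult:
  assumes "Z \<in> siegel_dom N" "a' * d' - b' * c' = 1"
  shows "aut (c * a' + d * c') (c * b' + d * d') Z = aut c d (sl_act N a' b' c' d' Z) * aut c' d' Z"
proof -
  obtain \<tau> z \<tau>' where [simp]: "Z = (\<tau>, z, \<tau>')" by (cases Z)
  show ?thesis
    using aut_nonzero[OF assms] by (simp add: aut_def sl_act_def field_simps)
qed

lemma sl_act_mult:
  assumes Z: "Z \<in> siegel_dom N" and det': "a' * d' - b' * c' = 1" and det: "a * d - b * c = 1"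
  shows "sl_act N (a * a' + b * c') (a * b' + b * d') (c * a' + d * c') (c * b' + d * d') Z
    = sl_act N a b c d (sl_act N a' b' c' d' Z)"
proof -
  obtain \<tau> z \<tau>' where Z_eq [simp]: "Z = (\<tau>, z, \<tau>')" by (cases Z)
  define j where "j = of_real c' * \<tau> + of_real d'"
  define j2 where "j2 = of_real c * ((of_real a' * \<tau> + of_real b') / j) + of_real d"
  define k where "k = of_real (c * a' + d * c') * \<tau> + (of_real (c * b' + d * d') :: complex)"
  have j0: "j \<noteq> 0" using aut_nonzero[OF Z det'] by (simp add: aut_def j_def)
  have j20: "j2 \<noteq> 0" using aut_nonzero[OF sl_act_dom[OF Z det'] det]
    by (simp add: aut_def j_def j2_def sl_act_def)
  have k: "k = j2 * j"
    using aut_mult[OF Z det', of c d] by (simp add: aut_def j_def j2_def k_def sl_act_def)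
  have 1: "(of_real (a * a' + b * c') * \<tau> + of_real (a * b' + b * d')) / k
    = (of_real a * ((of_real a' * \<tau> + of_real b') / j) + of_real b) / j2"
    using j0 j20 unfolding k by (simp add: field_simps) (simp add: j_def algebra_simps)
  have 2: "z / k = z / j / j2" by (simp add: k)
  have kk: "k = of_real c * (of_real a' * \<tau> + of_real b') + of_real d * j"
    by (simp add: k_def j_def algebra_simps)
  \<comment> \<open>The determinant of the inner matrix splits the correction of
    \<open>\<tau>'\<close> for the product into the corrections for the two factors.\<close>
  have "of_real (c * a' + d * c') * j = of_real c' * k + of_real c * of_real (a' * d' - b' * c')"
    by (simp add: kk j_def algebra_simps)
  then have c: "of_real (c * a' + d * c') * j = of_real c' * k + of_real c"
    using det' by simp
  have "of_real (c * a' + d * c') / k = of_real c' / j + of_real c / (j * k)"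
    using c j0 j20 k by (simp add: field_simps)
  also have "\<dots> = of_real c' / j + of_real c / (j\<^sup>2 * j2)"
    by (simp add: k power2_eq_square mult_ac)
  finally have "of_real N * z\<^sup>2 * (of_real (c * a' + d * c') / k)
      = of_real N * z\<^sup>2 * (of_real c' / j + of_real c / (j\<^sup>2 * j2))" by simp
  then have 3: "of_real N * of_real (c * a' + d * c') * z\<^sup>2 / k
      = of_real N * of_real c' * z\<^sup>2 / j + of_real N * of_real c * (z / j)\<^sup>2 / j2"
    by (simp add: distrib_left power_divide mult_ac)
  show ?thesis
    unfolding Z_eq sl_act_def prod.case k_def[symmetric] j_def[symmetric] j2_def[symmetric] 1 2 3
    by (simp only: diff_diff_eq)
qed

lemma sl_act_one: "sl_act N 1 0 0 1 Z = Z" "aut 0 1 Z = 1"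
  by (cases Z, simp add: sl_act_def) (simp add: aut_def)

section \<open>Weight \<open>l\<close> invariance under a single real matrix of determinant 1; such
  matrices form a group\<close>

definition slash_inv :: "real \<Rightarrow> nat \<Rightarrow> (point \<Rightarrow> complex) \<Rightarrow> real \<Rightarrow> real \<Rightarrow> real \<Rightarrow> real \<Rightarrow> bool" where
  "slash_inv N l F a b c d \<longleftrightarrow> a * d - b * c = 1 \<and>
     (\<forall>Z\<in>siegel_dom N. F (sl_act N a b c d Z) = aut c d Z ^ l * F Z)"

lemma slash_inv_mult:
  assumes g: "slash_inv N l F a b c d" and h: "slash_inv N l F a' b' c' d'"
  shows "slash_inv N l F (a * a' + b * c') (a * b' + b * d') (c * a' + d * c') (c * b' + d * d')"
  unfolding slash_inv_def
proof (intro conjI ballI)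
  have det: "a * d - b * c = 1" "a' * d' - b' * c' = 1" using assms by (auto simp: slash_inv_def)
  have "(a * a' + b * c') * (c * b' + d * d') - (a * b' + b * d') * (c * a' + d * c')
    = (a * d - b * c) * (a' * d' - b' * c')" by (simp add: algebra_simps)
  then show "(a * a' + b * c') * (c * b' + d * d') - (a * b' + b * d') * (c * a' + d * c') = 1"
    using det by simp
  fix Z assume Z: "Z \<in> siegel_dom N"
  show "F (sl_act N (a * a' + b * c') (a * b' + b * d') (c * a' + d * c') (c * b' + d * d') Z)
    = aut (c * a' + d * c') (c * b' + d * d') Z ^ l * F Z"
    using g h Z det sl_act_dom[OF Z det(2)]
    by (simp add: slash_inv_def sl_act_mult aut_mult power_mult_distrib)
qed

lemma slash_inv_inverse:
  assumes g: "slash_inv N l F a b c d"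
  shows "slash_inv N l F d (- b) (- c) a"
  unfolding slash_inv_def
proof (intro conjI ballI)
  have det: "a * d - b * c = 1" using assms by (auto simp: slash_inv_def)
  then show det': "d * a - - b * - c = 1" by (simp add: algebra_simps)
  fix Z assume Z: "Z \<in> siegel_dom N"
  let ?Y = "sl_act N d (- b) (- c) a Z"
  have Y: "?Y \<in> siegel_dom N" by (rule sl_act_dom[OF Z det'])
  have e: "a * d + b * - c = 1" "a * - b + b * a = 0" "c * d + d * - c = 0" "c * - b + d * a = 1"
    using det by (simp_all add: algebra_simps)
  have "sl_act N a b c d ?Y = Z"
    using sl_act_mult[OF Z det' det] unfolding e by (simp add: sl_act_one)
  then have F: "F Z = aut c d ?Y ^ l * F ?Y"
    using g Y by (auto simp: slash_inv_def)
  have "aut c d ?Y * aut (- c) a Z = 1"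
    using aut_mult[OF Z det', of c d] unfolding e by (simp add: sl_act_one)
  then show "F ?Y = aut (- c) a Z ^ l * F Z"
    unfolding F mult.assoc[symmetric] power_mult_distrib[symmetric] by (simp add: mult.commute)
qed

lemma slash_inv_translation_mult:
  assumes "slash_inv N l F 1 x 0 1"
  shows "slash_inv N l F 1 (of_int k * x) 0 1"
proof -
  have nat: "slash_inv N l F 1 (of_nat k * x) 0 1" for k
  proof (induction k)
    case 0
    show ?case by (simp add: slash_inv_def sl_act_one)
  next
    case (Suc k)
    show ?case using slash_inv_mult[OF assms Suc] by (simp add: algebra_simps)
  qed
  show ?thesis
  proof (cases "k \<ge> 0")
    case True
    then show ?thesis using nat[of "nat k"] by simp
  next
    case False
    then show ?thesis using slash_inv_inverse[OF nat[of "nat (- k)"]] by simp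
  qed
qed

lemma slash_inv_lower_mult:
  assumes "slash_inv N l F 1 0 1 1"
  shows "slash_inv N l F 1 0 (of_int k) 1"
proof -
  have nat: "slash_inv N l F 1 0 (of_nat k) 1" for k
  proof (induction k)
    case 0
    show ?case by (simp add: slash_inv_def sl_act_one)
  next
    case (Suc k)
    show ?case using slash_inv_mult[OF assms Suc] by (simp add: algebra_simps)
  qed
  show ?thesis
  proof (cases "k \<ge> 0")
    case True
    then show ?thesis using nat[of "nat k"] by simp
  next
    case False
    then show ?thesis using slash_inv_inverse[OF nat[of "nat (- k)"]] by simp
  qed
qed

section \<open>Principal congruence subgroups and arbitrarily small translations\<close>

definition level_inv :: "real \<Rightarrow> nat \<Rightarrow> int \<Rightarrow> (point \<Rightarrow> complex) \<Rightarrow> bool" where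
  "level_inv N l M F \<longleftrightarrow> (\<forall>a b c d. a * d - b * c = 1 \<and> M dvd a - 1 \<and> M dvd b \<and> M dvd c \<and> M dvd d - 1
     \<longrightarrow> slash_inv N l F (of_int a) (of_int b) (of_int c) (of_int d))"

lemma level_invD:
  assumes "level_inv N l M F" "a * d - b * c = 1" "M dvd a - 1" "M dvd b" "M dvd c" "M dvd d - 1"
  shows "slash_inv N l F (of_int a) (of_int b) (of_int c) (of_int d)"
  using assms by (auto simp: level_inv_def)

text \<open>The Euclidean algorithm on the first column: the two unipotents act by row operations
  and generate the integral special linear group.\<close>

lemma level_inv_1:
  assumes T: "slash_inv N l F 1 1 0 1" and L: "slash_inv N l F 1 0 1 1"
  shows "level_inv N l 1 F"
proof -
  have T': "slash_inv N l F 1 (of_int k) 0 1" for k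
    using slash_inv_translation_mult[OF T, of k] by simp
  have L': "slash_inv N l F 1 0 (of_int k) 1" for k
    by (rule slash_inv_lower_mult[OF L])
  \<comment> \<open>This fact and the next run backwards: after a row operation the matrix is
    already handled, and the inverse operation recovers the given one.\<close>
  have Tm: "slash_inv N l F (of_int a) (of_int b) (of_int c) (of_int d)"
    if "slash_inv N l F (of_int (a + k * c)) (of_int (b + k * d)) (of_int c) (of_int d)"
    for a b c d k :: int
    using slash_inv_mult[OF T'[of "- k"] that] by (simp add: algebra_simps)
  have Lm: "slash_inv N l F (of_int a) (of_int b) (of_int c) (of_int d)"
    if "slash_inv N l F (of_int a) (of_int b) (of_int (c + k * a)) (of_int (d + k * b))"
    for a b c d k :: int
    using slash_inv_mult[OF L'[of "- k"] that] by (simp add: algebra_simps)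
  have one: "slash_inv N l F 1 (of_int b) (of_int c) (of_int d)" if "d - b * c = 1" for b c d :: int
  proof -
    have "real_of_int d = 1 + b * c" using that by (simp add: algebra_simps flip: of_int_mult)
    then show ?thesis using slash_inv_mult[OF L'[of c] T'[of b]] by (simp add: mult.commute add.commute)
  qed
  have "slash_inv N l F (of_int a) (of_int b) (of_int c) (of_int d)" if "a * d - b * c = 1"
    for a b c d :: int
    using that
  proof (induction "nat (\<bar>a\<bar> + \<bar>c\<bar>)" arbitrary: a b c d rule: less_induct)
    case less
    consider "a = 1" | "a = 0" | "a \<noteq> 0" "a \<noteq> 1" "c = 0"
      | "a \<noteq> 0" "c \<noteq> 0" "\<bar>c\<bar> \<le> \<bar>a\<bar>" | "a \<noteq> 0" "c \<noteq> 0" "\<bar>a\<bar> < \<bar>c\<bar>" by linarith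
    then show ?case
    proof cases
      case 1
      then show ?thesis using one[of d b c] less.prems by simp
    next
      case 2
      then have "c = 1 \<or> c = - 1" using less.prems zmult_eq_1_iff[of "- b" c] by auto
      then have c: "c * c = 1" by auto
      have "slash_inv N l F 1 (of_int (b + c * d)) (of_int c) (of_int d)"
        using less.prems 2 c by (intro one) (simp add: algebra_simps)
      then show ?thesis using Tm[of a c c b d] 2 c by simp
    next
      case 3
      then have "a = -1" "d = -1" using less.prems zmult_eq_1_iff[of a d] by auto
      \<comment> \<open>The first column goes from \<open>(-1, 0)\<close> through
        \<open>(-1, -1)\<close> to \<open>(1, -1)\<close>, where the upper left entry is 1.\<close>
      have "slash_inv N l F (of_int 1) (of_int (b - 2 * (d + b))) (of_int (- 1)) (of_int (d + b))"
        using \<open>d = -1\<close> one[of "d + b" "b - 2 * (d + b)" "- 1"] by simp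
      then have "slash_inv N l F (of_int a) (of_int b) (of_int (- 1)) (of_int (d + b))"
        using Tm[of a "-2" "- 1" b "d + b"] \<open>a = -1\<close> by simp
      then show ?thesis using Lm[of a b c 1 d] \<open>a = -1\<close> 3 by simp
    next
      case 4
      define k where "k = (if sgn a = sgn c then - 1 else 1 :: int)"
      have "\<bar>a + k * c\<bar> < \<bar>a\<bar>" using 4 by (auto simp: k_def sgn_if split: if_splits)
      then show ?thesis
        using less.prems by (intro Tm[of a k c b d] less.hyps) (auto simp: algebra_simps)
    next
      case 5
      define k where "k = (if sgn a = sgn c then - 1 else 1 :: int)"
      have "\<bar>c + k * a\<bar> < \<bar>c\<bar>" using 5 by (auto simp: k_def sgn_if split: if_splits)
      then show ?thesis
        using less.prems by (intro Lm[of a b c k d] less.hyps) (auto simp: algebra_simps)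
    qed
  qed
  then show ?thesis by (simp add: level_inv_def)
qed

text \<open>With \<open>a = M Y\<close> and \<open>u = (1 - a M b') / q\<close> the element
  \<open>h = [[q u, (a / q) (1 + q u)], [- q M b', q u]]\<close> is the product of an upper unipotent with entry
  \<open>a / q\<close>, an element of level \<open>M\<close>, and the same upper unipotent.  It conjugates the
  lower unipotent with entry \<open>M\<close> to a matrix whose only non-integral entry has denominator \<open>q\<^sup>2\<close>;
  a factor of level \<open>M\<close> makes this matrix upper unipotent.\<close>
lemma finer_translation:
  fixes M q Y :: int
  assumes lev: "level_inv N l M F" and q: "q > 1" and cop: "coprime q M" "coprime Y q"
    and inv: "slash_inv N l F 1 (of_int Y / of_int q) 0 1"
  obtains Y' where "coprime Y' (q\<^sup>2)" "slash_inv N l F 1 (of_int Y' / of_int (q\<^sup>2)) 0 1"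
proof -
  define a where "a = M * Y"
  have inva: "slash_inv N l F 1 (of_int a / of_int q) 0 1"
    using slash_inv_translation_mult[OF inv, of M] by (simp add: a_def)
  have copa: "coprime a q" using cop by (simp add: a_def coprime_commute)
  \<comment> \<open>Bezout modulo \<open>q\<^sup>2\<close> instead of \<open>q\<close> makes
    \<open>u\<close> a multiple of \<open>q\<close>, which lets \<open>C\<close> divide
    \<open>K ^ 4\<close> below.\<close>
  then have "coprime (a * M) (q\<^sup>2)" using cop by (simp add: coprime_commute)
  then obtain b' k where "b' * (a * M) + k * q\<^sup>2 = 1"
    using bezout_int[of "a * M" "q\<^sup>2"] by (auto simp: coprime_iff_gcd_eq_1)
  define u where "u = k * q"
  have b': "a * M * b' = 1 - q * u"
    using \<open>b' * (a * M) + k * q\<^sup>2 = 1\<close> by (simp add: u_def power2_eq_square algebra_simps)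
  have b'r: "real_of_int a * real_of_int M * real_of_int b' = 1 - real_of_int q * real_of_int u"
    using arg_cong[OF b', of real_of_int] by simp
  have q0: "real_of_int q \<noteq> 0" using q by simp
  define \<beta> where "\<beta> = real_of_int a * (1 + q * u) / q"
  have low: "slash_inv N l F 1 0 (of_int (M * e)) 1" for e
    using level_invD[OF lev, of 1 1 0 "M * e"] by simp
  have "slash_inv N l F 1 (a / q) (of_int (M * (- q * b'))) (q * u)"
  proof -
    have "of_int (M * (- q * b')) * (a / q) + 1 * 1 = real_of_int q * u"
      using b'r q0 by (simp add: field_simps)
    then show ?thesis using slash_inv_mult[OF low[of "- q * b'"] inva] by simp
  qed
  note 1 = slash_inv_mult[OF inva this]
  have "1 * 1 + a / q * of_int (M * (- q * b')) = real_of_int q * u"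
    using b'r q0 by (simp add: field_simps)
  moreover have "1 * (a / q) + a / q * (q * u) = \<beta>"
    using q0 by (simp add: \<beta>_def field_simps)
  ultimately have h: "slash_inv N l F (q * u) \<beta> (- real_of_int (q * M * b')) (q * u)"
    using 1 by (simp add: mult_ac)
  \<comment> \<open>\<open>A\<close>, \<open>B\<close>, \<open>C\<close>, \<open>D\<close> are the
    entries of the conjugate by h of the lower unipotent with entry \<open>M\<close>; only
    \<open>B\<close> inherits the denominator of \<open>\<beta>\<^sup>2\<close>.\<close>
  define K where "K = M * a * u * (1 + q * u)"
  define A where "A = 1 + K"
  define C where "C = M * q\<^sup>2 * u\<^sup>2"
  define D where "D = 1 - K"
  define B where "B = - M * \<beta>\<^sup>2"
  have \<beta>u: "\<beta> * (q * u) = a * u * (1 + q * u)" using q0 by (simp add: \<beta>_def)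
  have h1: "slash_inv N l F (q * u + \<beta> * M) \<beta> (- real_of_int (q * M * b') + q * u * M) (q * u)"
    using slash_inv_mult[OF h low[of 1]] by simp
  have deth: "real_of_int q * u * (q * u) + \<beta> * (q * M * b') = 1"
    using h by (simp add: slash_inv_def)
  have "slash_inv N l F ((q * u + \<beta> * M) * (q * u) + \<beta> * (q * M * b'))
      ((q * u + \<beta> * M) * - \<beta> + \<beta> * (q * u))
      ((- real_of_int (q * M * b') + q * u * M) * (q * u) + (q * u) * (q * M * b'))
      ((- real_of_int (q * M * b') + q * u * M) * - \<beta> + (q * u) * (q * u))"
    using slash_inv_mult[OF h1 slash_inv_inverse[OF h]] by simp
  moreover have "(q * u + \<beta> * M) * (q * u) + \<beta> * (q * M * b') = of_int A"
  proof -
    have "of_int A = 1 + M * (\<beta> * (q * u))" unfolding \<beta>u by (simp add: A_def K_def)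
    also have "\<dots> = (q * u + \<beta> * M) * (q * u) + \<beta> * (q * M * b')"
      using deth by (simp add: algebra_simps)
    finally show ?thesis by simp
  qed
  moreover have "(q * u + \<beta> * M) * - \<beta> + \<beta> * (q * u) = B"
    by (simp add: B_def power2_eq_square algebra_simps)
  moreover have "(- real_of_int (q * M * b') + q * u * M) * (q * u) + (q * u) * (q * M * b') = of_int C"
    by (simp add: C_def power2_eq_square algebra_simps)
  moreover have "(- real_of_int (q * M * b') + q * u * M) * - \<beta> + (q * u) * (q * u) = of_int D"
  proof -
    have "of_int D = 1 - M * (\<beta> * (q * u))" unfolding \<beta>u by (simp add: D_def K_def)
    also have "\<dots> = (- real_of_int (q * M * b') + q * u * M) * - \<beta> + (q * u) * (q * u)"
      using deth by (simp add: algebra_simps)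
    finally show ?thesis by simp
  qed
  ultimately have g: "slash_inv N l F (of_int A) B (of_int C) (of_int D)" by simp
  \<comment> \<open>\<open>C\<close> divides \<open>K ^ 4\<close> and \<open>A = 1 + K\<close>, so
    the first column \<open>(A, C)\<close> is unimodular.\<close>
  have "K ^ 4 = C * (M ^ 3 * a ^ 4 * k\<^sup>2 * (1 + q * u) ^ 4)"
    by (simp add: K_def C_def u_def power_mult_distrib power2_eq_square power3_eq_cube power4_eq_xxxx)
  moreover have "coprime A (K ^ 4)"
    using coprime_add_one_left[of K] unfolding A_def by (subst (asm) add.commute) simp
  ultimately have "coprime A C" by simp
  then obtain t0 w0 where tw0: "t0 * A + w0 * C = 1"
    using bezout_int[of A C] by (auto simp: coprime_iff_gcd_eq_1)
  \<comment> \<open>Bezout completes the column \<open>(A, C)\<close> by \<open>(- w0, t0)\<close>.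
    Adding \<open>w0\<close> times the first column to it makes \<open>w\<close> divisible by
    \<open>A - 1\<close>, hence by \<open>M\<close>, so the completed matrix has level
    \<open>M\<close>.\<close>
  define w where "w = - w0 * (1 - A)"
  define t where "t = t0 + w0 * C"
  have tw: "A * t - w * C = 1" using tw0 by (simp add: w_def t_def algebra_simps)
  have dv: "M dvd C" "M dvd A - 1" "M dvd w"
    by (simp_all add: C_def A_def K_def w_def dvd_mult)
  have "t - 1 = - t * (A - 1) + w * C" using tw by (simp add: algebra_simps)
  then have "M dvd t - 1" using dv by (metis dvd_add dvd_mult)
  then have "slash_inv N l F (of_int A) (of_int w) (of_int C) (of_int t)"
    using level_invD[OF lev tw] dv by simp
  from slash_inv_mult[OF slash_inv_inverse[OF this] g]
  have fin: "slash_inv N l F (t * A - w * C) (t * B - w * D) (- C * A + A * C) (- C * B + A * D)"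
    by simp
  define Y' where "Y' = - (t * M * a\<^sup>2 * (1 + q * u)\<^sup>2) - w * D * q\<^sup>2"
  have z: "of_int t * B - of_int w * of_int D = of_int Y' / of_int (q\<^sup>2)"
  proof -
    have "\<beta>\<^sup>2 = (real_of_int a)\<^sup>2 * (1 + q * u)\<^sup>2 / (real_of_int q)\<^sup>2"
      by (simp add: \<beta>_def power_mult_distrib power_divide)
    then show ?thesis using q0 by (simp add: Y'_def B_def diff_divide_distrib mult_ac)
  qed
  have "- C * B + A * D = 1"
    using g by (simp add: slash_inv_def algebra_simps)
  moreover have "real_of_int t * A - w * C = 1"
    using arg_cong[OF tw, of real_of_int] by (simp add: algebra_simps)
  ultimately have "slash_inv N l F 1 (of_int Y' / of_int (q\<^sup>2)) 0 1"
    using fin by (simp add: z)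
  moreover have "coprime Y' (q\<^sup>2)"
  proof -
    have "coprime t q"
    proof (rule coprimeI)
      fix e assume e: "e dvd t" "e dvd q"
      then have "e dvd C" by (simp add: C_def power2_eq_square)
      then have "e dvd A * t - w * C" using e by (intro dvd_diff dvd_mult) auto
      then show "is_unit e" using tw by simp
    qed
    moreover have "coprime (1 + q * u) q"
    proof (rule coprimeI)
      fix e assume "e dvd 1 + q * u" "e dvd q"
      then show "is_unit e" using dvd_diff[of e "1 + q * u" "q * u"] by simp
    qed
    ultimately have "coprime (t * M * a\<^sup>2 * (1 + q * u)\<^sup>2) q"
      using cop copa by (simp add: coprime_commute)
    then have "coprime (- (t * M * a\<^sup>2 * (1 + q * u)\<^sup>2) + (- w * D * q) * q) q"
      by (metis coprime_minus_left_iff gcd_add_mult coprime_iff_gcd_eq_1 gcd.commute add.commute mult.commute)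
    moreover have "Y' = - (t * M * a\<^sup>2 * (1 + q * u)\<^sup>2) + (- w * D * q) * q"
      by (simp add: Y'_def power2_eq_square)
    ultimately show ?thesis by simp
  qed
  ultimately show thesis using that by blast
qed

text \<open>Each refinement squares the denominator and keeps the numerator prime to it. After
  \<open>m\<close> refinements the denominator \<open>q ^ 2 ^ m\<close> exceeds \<open>m\<close>, so
  it cannot divide \<open>m\<close> times the numerator.\<close>

lemma fine_translations:
  fixes M q :: int
  assumes lev: "level_inv N l M F" and q: "q > 1" and cop: "coprime q M"
    and inv: "slash_inv N l F 1 (1 / of_int q) 0 1" and m: "m > 0"
  obtains x where "slash_inv N l F 1 x 0 1" "real m * x \<notin> \<int>"
proof -
  have "\<exists>Y. coprime Y (q ^ 2 ^ j) \<and> slash_inv N l F 1 (of_int Y / of_int (q ^ 2 ^ j)) 0 1" for j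
  proof (induction j)
    case 0
    show ?case using inv by (intro exI[of _ 1]) simp
  next
    case (Suc j)
    then obtain Y where Y: "coprime Y (q ^ 2 ^ j)"
      "slash_inv N l F 1 (of_int Y / of_int (q ^ 2 ^ j)) 0 1" by blast
    have "1 < q ^ 2 ^ j" using q by (intro one_less_power) auto
    moreover have "coprime (q ^ 2 ^ j) M" using cop by simp
    ultimately obtain Y' where "coprime Y' ((q ^ 2 ^ j)\<^sup>2)"
      "slash_inv N l F 1 (of_int Y' / of_int ((q ^ 2 ^ j)\<^sup>2)) 0 1"
      using finer_translation[OF lev _ _ Y] by blast
    then show ?case by (auto simp: power_mult[symmetric] mult.commute)
  qed
  then obtain Y where Y: "coprime Y (q ^ 2 ^ m)"
    "slash_inv N l F 1 (of_int Y / of_int (q ^ 2 ^ m)) 0 1" by blast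
  have "m < 2 ^ m" by (rule less_exp)
  also have "(2::nat) ^ m < 2 ^ 2 ^ m" by (intro power_strict_increasing less_exp) auto
  finally have "int m < 2 ^ 2 ^ m" by (metis of_nat_less_iff of_nat_numeral of_nat_power)
  also have "(2::int) ^ 2 ^ m \<le> q ^ 2 ^ m" using q by (intro power_mono) auto
  finally have lt: "int m < q ^ 2 ^ m" .
  have "real m * (of_int Y / of_int (q ^ 2 ^ m)) \<notin> \<int>"
  proof
    assume "real m * (of_int Y / of_int (q ^ 2 ^ m)) \<in> \<int>"
    then obtain k where "real m * (of_int Y / of_int (q ^ 2 ^ m)) = of_int k" by (elim Ints_cases)
    then have "of_int (int m * Y) = real_of_int (k * q ^ 2 ^ m)"
      using q by (simp add: field_simps)
    then have "int m * Y = k * q ^ 2 ^ m" using of_int_eq_iff by blast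
    then have "q ^ 2 ^ m dvd int m"
      using Y(1) by (metis coprime_commute coprime_dvd_mult_left_iff dvd_triv_right)
    then show False using lt m zdvd_imp_le by fastforce
  qed
  then show thesis using that Y(2) by blast
qed

section \<open>Fourier series\<close>

definition ee :: "complex \<Rightarrow> complex" where
  "ee x = exp (2 * of_real pi * \<i> * x)"

lemma ee_add: "ee (x + y) = ee x * ee y"
  by (simp add: ee_def distrib_left exp_add)

lemma ee_nonzero [simp]: "ee x \<noteq> 0"
  by (simp add: ee_def)

lemma ee_of_real_eq_1: "ee (of_real x) = 1 \<longleftrightarrow> x \<in> \<int>"
proof -
  have "ee (of_real x) = 1 \<longleftrightarrow> (\<exists>n::int. 2 * pi * x = of_int (2 * n) * pi)"
    by (simp add: ee_def exp_eq_1)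
  also have "\<dots> \<longleftrightarrow> (\<exists>n::int. x = of_int n)" by (auto simp: field_simps)
  finally show ?thesis by (auto simp: Ints_def)
qed

lemma ee_of_nat_mult: "ee (of_nat k * x) = ee x ^ k"
  by (simp add: ee_def exp_of_nat_mult[symmetric] mult_ac)

lemma has_sum_minus:
  fixes f g :: "'i \<Rightarrow> complex"
  assumes "(f has_sum a) A" "(g has_sum b) A"
  shows "((\<lambda>i. f i - g i) has_sum (a - b)) A"
proof -
  have "((\<lambda>i. - g i) has_sum (- b)) A"
    by (subst has_sum_uminus) (use assms(2) in simp)
  from has_sum_add[OF assms(1) this] show ?thesis by simp
qed

lemma has_sum_finite_sum:
  fixes f :: "'j \<Rightarrow> 'i \<Rightarrow> complex"
  assumes "finite J" "\<And>j. j \<in> J \<Longrightarrow> (f j has_sum a j) A"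
  shows "((\<lambda>i. \<Sum>j\<in>J. f j i) has_sum (\<Sum>j\<in>J. a j)) A"
  using assms
proof (induction J)
  case (insert j J)
  then have "(f j has_sum a j) A" "((\<lambda>i. \<Sum>j\<in>J. f j i) has_sum (\<Sum>j\<in>J. a j)) A" by auto
  from has_sum_add[OF this] show ?case using insert.hyps by simp
qed simp

lemma has_sum_fibers:
  fixes a :: "'i \<Rightarrow> complex" and h :: "'i \<Rightarrow> nat"
  assumes "(a has_sum S) X"
  shows "((\<lambda>k. infsum a {i\<in>X. h i = k}) has_sum S) UNIV"
proof (rule has_sum_SigmaD)
  have "bij_betw snd (SIGMA k:UNIV. {i\<in>X. h i = k}) X"
    by (rule bij_betw_byWitness[where f' = "\<lambda>i. (h i, i)"]) auto
  from has_sum_reindex_bij_betw[OF this, of a S] assms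
  show "((\<lambda>x. a (snd x)) has_sum S) (SIGMA k:UNIV. {i\<in>X. h i = k})" by (rule iffD2)
next
  fix k :: nat
  have "a summable_on X" using assms by (auto simp: summable_on_def)
  then have "a summable_on {i\<in>X. h i = k}" by (rule summable_on_subset_banach) auto
  then show "((\<lambda>i. a (snd (k, i))) has_sum infsum a {i\<in>X. h i = k}) {i\<in>X. h i = k}"
    unfolding snd_conv by (rule has_sum_infsum)
qed

text \<open>This extracts Fourier coefficients without integration: \<open>ee t\<close> takes every
  value in the punctured unit disc, and a power series that vanishes there has zero
  coefficients.\<close>

lemma fiber_sum_zero:
  fixes a :: "'i \<Rightarrow> complex" and h :: "'i \<Rightarrow> nat"
  assumes "\<And>t. Im t \<ge> 0 \<Longrightarrow> ((\<lambda>i. a i * ee (of_nat (h i) * t)) has_sum 0) X"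
  shows "infsum a {i\<in>X. h i = k} = 0"
proof (rule ccontr)
  assume nz: "infsum a {i\<in>X. h i = k} \<noteq> 0"
  define b where "b k = infsum a {i\<in>X. h i = k}" for k
  have sums: "(\<lambda>k. b k * w ^ k) sums 0" if w: "0 < cmod w" "cmod w < 1" for w
  proof -
    define t where "t = Ln w / (2 * of_real pi * \<i>)"
    have ew: "ee t = w" using w by (simp add: ee_def t_def)
    have "Im t = - ln (cmod w) / (2 * pi)"
      using w by (simp add: t_def Im_divide power2_eq_square)
    then have "Im t \<ge> 0" using w by (simp add: divide_nonpos_pos)
    then have "((\<lambda>i. a i * w ^ h i) has_sum 0) X"
      using assms[of t] by (simp add: ee_of_nat_mult ew)
    then have "((\<lambda>k. infsum (\<lambda>i. a i * w ^ h i) {i\<in>X. h i = k}) has_sum 0) UNIV"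
      by (rule has_sum_fibers)
    moreover have "infsum (\<lambda>i. a i * w ^ h i) {i\<in>X. h i = k} = b k * w ^ k" for k
    proof -
      have "infsum (\<lambda>i. a i * w ^ h i) {i\<in>X. h i = k} = infsum (\<lambda>i. a i * w ^ k) {i\<in>X. h i = k}"
        by (rule infsum_cong) auto
      then show ?thesis by (simp add: infsum_cmult_left' b_def)
    qed
    ultimately show ?thesis by (simp add: has_sum_imp_sums)
  qed
  text \<open>The shift by one power of \<open>w\<close> makes the sum vanish at \<open>w = 0\<close> as well.\<close>
  define c where "c n = (case n of 0 \<Rightarrow> 0 | Suc k \<Rightarrow> b k)" for n
  have "(\<lambda>n. c n * (w - 0) ^ n) sums 0" if "norm (w - 0) < 1" for w
  proof (cases "w = 0")
    case True
    then have "(\<lambda>n. c n * (w - 0) ^ n) = (\<lambda>n. 0)" by (auto simp: c_def fun_eq_iff split: nat.splits)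
    then show ?thesis by simp
  next
    case False
    then have "(\<lambda>k. w * (b k * w ^ k)) sums (w * 0)"
      using that by (intro sums_mult sums) auto
    then have "(\<lambda>k. c (Suc k) * w ^ Suc k) sums 0" by (simp add: c_def mult_ac)
    then show ?thesis by (subst (asm) sums_Suc_iff) (simp add: c_def)
  qed
  moreover have "c (Suc k) \<noteq> 0" using nz by (simp add: c_def b_def)
  \<comment> \<open>A power series with a nonzero coefficient has no zeros in some punctured ball
    around its centre; the zero function contradicts this.\<close>
  ultimately obtain s where s: "0 < s" "\<And>z. z \<in> cball (0::complex) s - {0} \<Longrightarrow> (\<lambda>_. 0::complex) z \<noteq> 0"
    using powser_0_nonzero[of 1 0 c "\<lambda>_. 0" "Suc k"] by auto
  show False using s(1) s(2)[of "of_real s"] by auto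
qed

lemma siegel_dom_shift1:
  assumes "(\<tau>, z, \<tau>') \<in> siegel_dom N" "Im t \<ge> 0" "N \<ge> 0"
  shows "(\<tau> + t, z, \<tau>') \<in> siegel_dom N"
proof -
  have *: "Im \<tau> > 0" "Im \<tau> * Im \<tau>' > N * (Im z)\<^sup>2" using assms by (auto simp: siegel_dom_def)
  have "0 \<le> N * (Im z)\<^sup>2" using assms by simp
  then have "0 < Im \<tau> * Im \<tau>'" using * by linarith
  then have "0 < Im \<tau>'" using * by (simp add: zero_less_mult_iff)
  then have "Im \<tau> * Im \<tau>' \<le> (Im \<tau> + Im t) * Im \<tau>'" using assms by (intro mult_right_mono) auto
  then show ?thesis using * assms(2) by (auto simp: siegel_dom_def)
qed

lemma siegel_dom_shift3:
  assumes "(\<tau>, z, \<tau>') \<in> siegel_dom N" "Im t \<ge> 0"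
  shows "(\<tau>, z, \<tau>' + t) \<in> siegel_dom N"
proof -
  have *: "Im \<tau> > 0" "Im \<tau> * Im \<tau>' > N * (Im z)\<^sup>2" using assms by (auto simp: siegel_dom_def)
  have "0 \<le> Im \<tau> * Im t" using * assms(2) by simp
  then show ?thesis using * by (simp add: siegel_dom_def distrib_left)
qed

section \<open>Fourier--Jacobi coefficients\<close>

text \<open>The tuple \<open>(m, r, c)\<close> stands for \<open>S = - m b\<^sub>4 - (r / \<alpha>) y\<^sup>\<or> - c b\<^sub>-\<^sub>4\<close>.\<close>
definition fidx :: "nat \<Rightarrow> (nat \<times> int \<times> nat) set" where
  "fidx \<alpha> = {(m, r, c). r\<^sup>2 \<le> 2 * int \<alpha> * int m * int c}"

text \<open>The interface between the spin group and the vanishing argument: one unipotent acting on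
  \<open>\<tau>\<close>, one acting on \<open>\<tau>'\<close> along \<open>z = 0\<close>, the
  expansion, and the vanishing of primitive coefficients. Invariance under
  \<open>\<tau> \<mapsto> \<tau> + 1\<close> is read off from the integral exponents.\<close>

locale fourier_form =
  fixes \<alpha> l :: nat and B :: "nat \<times> int \<times> nat \<Rightarrow> complex" and f :: "point \<Rightarrow> complex" and N :: real
  defines "N \<equiv> real \<alpha> / 2"
  assumes l: "l > 0"
    and expansion: "Z \<in> siegel_dom N \<Longrightarrow>
      ((\<lambda>(m, r, c). B (m, r, c) * ee (of_nat m * fst Z + of_int r * fst (snd Z) + of_nat c * snd (snd Z)))
        has_sum f Z) (fidx \<alpha>)"
    and lower_inv: "slash_inv N l f 1 0 1 1"
    and opposite_inv: "\<lbrakk>Im \<tau> > 0; Im \<tau>' > 0\<rbrakk> \<Longrightarrow> f (\<tau>, 0, \<tau>' / (\<tau>' + 1)) = (\<tau>' + 1) ^ l * f (\<tau>, 0, \<tau>')"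
    and primitive_zero: "gcd (int m) (gcd r (int c)) = 1 \<Longrightarrow> B (m, r, c) = 0"
begin

definition trm :: "point \<Rightarrow> nat \<times> int \<times> nat \<Rightarrow> complex" where
  "trm Z = (\<lambda>(m, r, c). B (m, r, c) * ee (of_nat m * fst Z + of_int r * fst (snd Z) + of_nat c * snd (snd Z)))"

definition cidx :: "nat \<Rightarrow> nat set \<Rightarrow> (nat \<times> int \<times> nat) set" where
  "cidx c T = {i\<in>fidx \<alpha>. snd (snd i) = c \<and> fst i \<in> T}"

text \<open>The exponential in \<open>\<tau>'\<close> stays inside, so plain weight \<open>l\<close>
  invariance under \<open>sl_act\<close> takes the place of a slash action of index
  \<open>c\<close>.\<close>

definition FJ :: "nat \<Rightarrow> nat set \<Rightarrow> point \<Rightarrow> complex" where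
  "FJ c T Z = infsum (trm Z) (cidx c T)"

lemma N_nonneg: "N \<ge> 0" by (simp add: N_def)

lemma trm_has_sum: "Z \<in> siegel_dom N \<Longrightarrow> (trm Z has_sum f Z) (fidx \<alpha>)"
  using expansion by (simp add: trm_def)

lemma trm_summable: "Z \<in> siegel_dom N \<Longrightarrow> Y \<subseteq> fidx \<alpha> \<Longrightarrow> trm Z summable_on Y"
  using trm_has_sum[of Z] by (intro summable_on_subset_banach[of "trm Z" "fidx \<alpha>" Y]) (auto simp: summable_on_def)

lemma FJ_has_sum: "Z \<in> siegel_dom N \<Longrightarrow> (trm Z has_sum FJ c T Z) (cidx c T)"
  unfolding FJ_def by (intro has_sum_infsum trm_summable) (auto simp: cidx_def)

lemma trm_shift1: "trm (\<tau> + t, z, \<tau>') i = trm (\<tau>, z, \<tau>') i * ee (of_nat (fst i) * t)"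
  by (cases i) (simp add: trm_def distrib_left add_ac mult.assoc ee_add[symmetric])

lemma trm_shift3: "trm (\<tau>, z, \<tau>' + t) i = trm (\<tau>, z, \<tau>') i * ee (of_nat (snd (snd i)) * t)"
  by (cases i) (simp add: trm_def distrib_left add_ac mult.assoc ee_add[symmetric])

lemma sl_act_translation: "sl_act N 1 x 0 1 (\<tau>, z, \<tau>') = (\<tau> + of_real x, z, \<tau>')"
  by (simp add: sl_act_def)

text \<open>Lower unipotents commute with the translations of \<open>\<tau>'\<close>, so the invariance of \<open>f\<close> passes to its
  Fourier coefficients with respect to \<open>\<tau>'\<close>.\<close>
lemma FJ_lower_inv: "slash_inv N l (FJ c UNIV) 1 0 1 1"
  unfolding slash_inv_def
proof (intro conjI ballI)
  fix Z assume Z: "Z \<in> siegel_dom N"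
  obtain \<tau> z \<tau>' where [simp]: "Z = (\<tau>, z, \<tau>')" by (cases Z)
  obtain \<upsilon> u \<upsilon>' where W: "sl_act N 1 0 1 1 Z = (\<upsilon>, u, \<upsilon>')" by (cases "sl_act N 1 0 1 1 Z")
  have Wd: "(\<upsilon>, u, \<upsilon>') \<in> siegel_dom N" using sl_act_dom[OF Z, of 1 1 0 1] W by simp
  define j where "j = aut 1 1 Z"
  have "((\<lambda>i. (trm (\<upsilon>, u, \<upsilon>') i - j ^ l * trm Z i) * ee (of_nat (snd (snd i)) * t)) has_sum 0) (fidx \<alpha>)"
    if t: "Im t \<ge> 0" for t
  proof -
    have Zt: "(\<tau>, z, \<tau>' + t) \<in> siegel_dom N" using siegel_dom_shift3[of \<tau> z \<tau>' N t] Z t by simp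
    have Wt: "(\<upsilon>, u, \<upsilon>' + t) \<in> siegel_dom N" using siegel_dom_shift3[OF Wd t] .
    have "sl_act N 1 0 1 1 (\<tau>, z, \<tau>' + t) = (\<upsilon>, u, \<upsilon>' + t)"
      using W by (auto simp: sl_act_def)
    then have "f (\<upsilon>, u, \<upsilon>' + t) = j ^ l * f (\<tau>, z, \<tau>' + t)"
      using lower_inv Zt by (fastforce simp: slash_inv_def j_def aut_def)
    then have "((\<lambda>i. trm (\<upsilon>, u, \<upsilon>' + t) i - j ^ l * trm (\<tau>, z, \<tau>' + t) i) has_sum 0) (fidx \<alpha>)"
      using has_sum_minus[OF trm_has_sum[OF Wt] has_sum_cmult_right[OF trm_has_sum[OF Zt], of "j ^ l"]]
      by simp
    then show ?thesis by (simp add: trm_shift3 algebra_simps)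
  qed
  from fiber_sum_zero[OF this, of c]
  have "infsum (\<lambda>i. trm (\<upsilon>, u, \<upsilon>') i - j ^ l * trm Z i) (cidx c UNIV) = 0"
    by (simp add: cidx_def)
  moreover have hs: "((\<lambda>i. trm (\<upsilon>, u, \<upsilon>') i - j ^ l * trm Z i) has_sum (FJ c UNIV (\<upsilon>, u, \<upsilon>') - j ^ l * FJ c UNIV Z))
      (cidx c UNIV)"
    by (intro has_sum_minus has_sum_cmult_right FJ_has_sum Wd Z)
  ultimately have "FJ c UNIV (\<upsilon>, u, \<upsilon>') - j ^ l * FJ c UNIV Z = 0"
    using infsumI[OF hs] by simp
  then show "FJ c UNIV (sl_act N 1 0 1 1 Z) = aut 1 1 Z ^ l * FJ c UNIV Z"
    unfolding W j_def by simp
qed simp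

text \<open>The term with exponent \<open>m\<close> is multiplied by
  \<open>ee (m x) = 1\<close>.\<close>

lemma FJ_translation_inv:
  assumes "\<And>m. m \<in> T \<Longrightarrow> real m * x \<in> \<int>"
  shows "slash_inv N l (FJ c T) 1 x 0 1"
  unfolding slash_inv_def
proof (intro conjI ballI)
  fix Z assume Z: "Z \<in> siegel_dom N"
  obtain \<tau> z \<tau>' where [simp]: "Z = (\<tau>, z, \<tau>')" by (cases Z)
  have "ee (of_nat m * of_real x) = 1" if "m \<in> T" for m
    using assms[OF that] ee_of_real_eq_1[of "real m * x"] by simp
  then have "FJ c T (\<tau> + of_real x, z, \<tau>') = FJ c T Z"
    unfolding FJ_def by (intro infsum_cong) (auto simp: trm_shift1 cidx_def)
  then show "FJ c T (sl_act N 1 x 0 1 Z) = aut 0 1 Z ^ l * FJ c T Z"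
    by (simp add: sl_act_translation sl_act_one)
qed simp

lemma FJ_level_1: "level_inv N l 1 (FJ c UNIV)"
  by (rule level_inv_1) (use FJ_translation_inv[of UNIV 1 c] FJ_lower_inv in auto)

section \<open>Removing the exponents divisible by \<open>p\<close>\<close>

lemma root_of_unity_sum:
  assumes "p > 0"
  shows "(\<Sum>j<p. ee (of_nat m * of_real (real j / real p))) = (if p dvd m then of_nat p else 0)"
proof -
  define w where "w = ee (of_real (real m / real p))"
  have w: "ee (of_nat m * of_real (real j / real p)) = w ^ j" for j
    unfolding w_def by (simp add: mult_ac flip: ee_of_nat_mult)
  have "w ^ p = ee (of_real (real m))"
    unfolding w_def using assms by (simp flip: ee_of_nat_mult)
  then have wp: "w ^ p = 1" using ee_of_real_eq_1[of "real m"] by simp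
  have "w = 1 \<longleftrightarrow> real m / real p \<in> \<int>" unfolding w_def by (rule ee_of_real_eq_1)
  also have "\<dots> \<longleftrightarrow> p dvd m"
  proof
    assume "real m / real p \<in> \<int>"
    then obtain k where "real m / real p = of_int k" by (elim Ints_cases)
    then have "real_of_int (int m) = of_int (k * int p)" using assms by (simp add: field_simps)
    then have "int m = k * int p" using of_int_eq_iff by blast
    then show "p dvd m" by (metis dvd_triv_right of_nat_dvd_iff)
  qed (use assms in \<open>auto elim!: dvdE\<close>)
  finally have w1: "w = 1 \<longleftrightarrow> p dvd m" .
  show ?thesis
    unfolding w sum_gp_strict w1 by (simp add: wp)
qed

text \<open>Averaging over the translations by \<open>j / p\<close> projects to the terms with
  \<open>p dvd m\<close>; the sum over the roots of unity kills all others.\<close>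

lemma FJ_average:
  assumes p: "p > 0" and Z: "Z \<in> siegel_dom N"
  shows "FJ c {m\<in>T. p dvd m} Z = (\<Sum>j<p. FJ c T (sl_act N 1 (real j / real p) 0 1 Z)) / of_nat p"
proof -
  obtain \<tau> z \<tau>' where [simp]: "Z = (\<tau>, z, \<tau>')" by (cases Z)
  have "((\<lambda>i. trm (\<tau> + of_real (real j / real p), z, \<tau>') i) has_sum
      FJ c T (sl_act N 1 (real j / real p) 0 1 Z)) (cidx c T)" for j
    using FJ_has_sum[OF sl_act_dom[OF Z, of 1 1 "real j / real p" 0]] by (simp add: sl_act_translation)
  then have "((\<lambda>i. \<Sum>j<p. trm (\<tau> + of_real (real j / real p), z, \<tau>') i) has_sum
      (\<Sum>j<p. FJ c T (sl_act N 1 (real j / real p) 0 1 Z))) (cidx c T)"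
    by (intro has_sum_finite_sum) auto
  moreover have "(\<Sum>j<p. trm (\<tau> + of_real (real j / real p), z, \<tau>') i)
      = (if p dvd fst i then of_nat p * trm Z i else 0)" for i
    unfolding trm_shift1 sum_distrib_left[symmetric] root_of_unity_sum[OF p] by simp
  ultimately have "infsum (\<lambda>i. if p dvd fst i then of_nat p * trm Z i else 0) (cidx c T)
      = (\<Sum>j<p. FJ c T (sl_act N 1 (real j / real p) 0 1 Z))"
    by (simp add: infsumI)
  moreover have "infsum (\<lambda>i. if p dvd fst i then of_nat p * trm Z i else 0) (cidx c T)
      = infsum (\<lambda>i. of_nat p * trm Z i) (cidx c {m\<in>T. p dvd m})"
    by (rule infsum_cong_neutral) (auto simp: cidx_def)
  ultimately show ?thesis
    using p by (simp add: infsum_cmult_right' FJ_def field_simps)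
qed

lemma level_inv_mono:
  assumes "level_inv N l M F" "M dvd M'"
  shows "level_inv N l M' F"
  unfolding level_inv_def
  using dvd_trans[OF assms(2)] by (intro allI impI level_invD[OF assms(1)]) auto

text \<open>Conjugation by the translation by \<open>j / p\<close> carries the congruence subgroup
  of level \<open>M p\<^sup>2\<close> into that of level \<open>M\<close>, so each summand of the
  average transforms correctly on its own.\<close>

lemma FJ_level_dvd:
  assumes lev: "level_inv N l M (FJ c T)" and p: "p > 0"
  shows "level_inv N l (M * (int p)\<^sup>2) (FJ c {m\<in>T. p dvd m})"
  unfolding level_inv_def
proof (intro allI impI, elim conjE)
  fix a b c' d :: int
  assume det: "a * d - b * c' = 1"
    and dvd: "M * (int p)\<^sup>2 dvd a - 1" "M * (int p)\<^sup>2 dvd b" "M * (int p)\<^sup>2 dvd c'" "M * (int p)\<^sup>2 dvd d - 1"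
  have detr: "real_of_int a * of_int d - of_int b * of_int c' = 1"
    using arg_cong[OF det, of real_of_int] by simp
  obtain a' where "a - 1 = M * (int p)\<^sup>2 * a'" using dvd(1) by (elim dvdE)
  then have a': "a = 1 + M * (int p)\<^sup>2 * a'" by simp
  obtain c'' where c'': "c' = M * (int p)\<^sup>2 * c''" using dvd(3) by (elim dvdE)
  obtain d' where "d - 1 = M * (int p)\<^sup>2 * d'" using dvd(4) by (elim dvdE)
  then have d': "d = 1 + M * (int p)\<^sup>2 * d'" by simp
  have bM: "M dvd b" using dvd(2) by (rule dvd_mult_left)
  show "slash_inv N l (FJ c {m\<in>T. p dvd m}) (of_int a) (of_int b) (of_int c') (of_int d)"
    unfolding slash_inv_def
  proof (intro conjI ballI detr)
    fix Z assume Z: "Z \<in> siegel_dom N"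
    have "FJ c T (sl_act N 1 (real j / real p) 0 1 (sl_act N a b c' d Z))
      = aut c' d Z ^ l * FJ c T (sl_act N 1 (real j / real p) 0 1 Z)" for j
    proof -
      \<comment> \<open>\<open>a1\<close>, \<open>b1\<close>, \<open>c'\<close>, \<open>d1\<close>
        are the entries of the conjugate by the translation by \<open>x\<close>. The factor
        \<open>p\<^sup>2\<close> of \<open>c'\<close> clears the denominators of both
        \<open>x\<close> and its square.\<close>
      define x where "x = real j / real p"
      define a1 where "a1 = a + int j * int p * M * c''"
      define d1 where "d1 = d - int j * int p * M * c''"
      define b1 where "b1 = b + int j * int p * M * (d' - a') - (int j)\<^sup>2 * M * c''"
      have px: "real p * x = real j" using p by (simp add: x_def)
      have a1: "real_of_int a1 = a + x * c'"
      proof -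
        have "real_of_int a1 = a + (real p * x) * p * M * c''" by (simp only: px) (simp add: a1_def)
        then show ?thesis by (simp add: c'' power2_eq_square algebra_simps)
      qed
      have d1: "real_of_int d1 = d - x * c'"
      proof -
        have "real_of_int d1 = d - (real p * x) * p * M * c''" by (simp only: px) (simp add: d1_def)
        then show ?thesis by (simp add: c'' power2_eq_square algebra_simps)
      qed
      have b1: "real_of_int b1 = b + x * d - x * a1"
      proof -
        have "real_of_int b1 = b + (real p * x) * p * M * (d' - a') - (real p * x)\<^sup>2 * M * c''"
          by (simp only: px) (simp add: b1_def)
        then show ?thesis unfolding a1 by (simp add: a' d' c'' power2_eq_square algebra_simps)
      qed
      have "real_of_int (a1 * d1 - b1 * c') = real_of_int a * of_int d - of_int b * of_int c'"
        by (simp add: a1 b1 d1 algebra_simps)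
      then have det1r: "real_of_int a1 * of_int d1 - of_int b1 * of_int c' = 1" using detr by simp
      then have det1: "a1 * d1 - b1 * c' = 1"
        by (metis of_int_1 of_int_diff of_int_eq_iff of_int_mult)
      have "slash_inv N l (FJ c T) a1 b1 c' d1"
        by (rule level_invD[OF lev det1])
           (use bM in \<open>auto simp: a1_def b1_def d1_def a' c'' d' intro!: dvd_add dvd_diff dvd_mult\<close>)
      then have inv: "FJ c T (sl_act N a1 b1 c' d1 (sl_act N 1 x 0 1 Z))
          = aut c' d1 (sl_act N 1 x 0 1 Z) ^ l * FJ c T (sl_act N 1 x 0 1 Z)"
        using sl_act_dom[OF Z, of 1 1 x 0] by (simp add: slash_inv_def)
      have "sl_act N 1 x 0 1 (sl_act N a b c' d Z) = sl_act N (a + x * c') (b + x * d) c' d Z"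
        using sl_act_mult[OF Z detr, of 1 1 x 0] by simp
      also have "\<dots> = sl_act N a1 b1 c' d1 (sl_act N 1 x 0 1 Z)"
      proof -
        have e: "real_of_int a1 * x + of_int b1 * 1 = b + x * d" "real_of_int c' * x + of_int d1 * 1 = d"
          using a1 b1 d1 by (simp_all add: algebra_simps)
        show ?thesis
          using sl_act_mult[OF Z, of 1 1 x 0 a1 d1 b1 c'] det1r unfolding e by (simp add: a1)
      qed
      finally have act: "sl_act N 1 x 0 1 (sl_act N a b c' d Z) = sl_act N a1 b1 c' d1 (sl_act N 1 x 0 1 Z)" .
      have "aut c' d1 (sl_act N 1 x 0 1 Z) = aut c' d Z"
        by (cases Z) (simp add: sl_act_translation aut_def d1 algebra_simps)
      then show ?thesis using act inv by (simp flip: x_def)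
    qed
    then show "FJ c {m\<in>T. p dvd m} (sl_act N a b c' d Z) = aut c' d Z ^ l * FJ c {m\<in>T. p dvd m} Z"
      unfolding FJ_average[OF p Z] FJ_average[OF p sl_act_dom[OF Z detr]]
      by (simp add: sum_distrib_left)
  qed
qed

lemma FJ_split:
  assumes "Z \<in> siegel_dom N"
  shows "FJ c T Z = FJ c {m\<in>T. p dvd m} Z + FJ c {m\<in>T. \<not> p dvd m} Z"
proof -
  have "cidx c T = cidx c {m\<in>T. p dvd m} \<union> cidx c {m\<in>T. \<not> p dvd m}"
    by (auto simp: cidx_def)
  then show ?thesis
    unfolding FJ_def by (auto intro!: infsum_Un_disjoint trm_summable assms simp: cidx_def)
qed

lemma FJ_level_not_dvd:
  assumes lev: "level_inv N l M (FJ c T)" and p: "p > 0"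
  shows "level_inv N l (M * (int p)\<^sup>2) (FJ c {m\<in>T. \<not> p dvd m})"
  unfolding level_inv_def
proof (intro allI impI, elim conjE)
  fix a b c' d :: int
  assume *: "a * d - b * c' = 1" "M * (int p)\<^sup>2 dvd a - 1" "M * (int p)\<^sup>2 dvd b"
    "M * (int p)\<^sup>2 dvd c'" "M * (int p)\<^sup>2 dvd d - 1"
  have 1: "slash_inv N l (FJ c T) a b c' d"
    by (rule level_invD[OF level_inv_mono[OF lev] *]) simp
  have 2: "slash_inv N l (FJ c {m\<in>T. p dvd m}) a b c' d"
    by (rule level_invD[OF FJ_level_dvd[OF lev p] *])
  show "slash_inv N l (FJ c {m\<in>T. \<not> p dvd m}) a b c' d"
    unfolding slash_inv_def
  proof (intro conjI ballI)
    show det: "real_of_int a * of_int d - of_int b * of_int c' = 1" using 1 by (simp add: slash_inv_def)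
    fix Z assume Z: "Z \<in> siegel_dom N"
    show "FJ c {m\<in>T. \<not> p dvd m} (sl_act N a b c' d Z) = aut c' d Z ^ l * FJ c {m\<in>T. \<not> p dvd m} Z"
      using 1 2 Z FJ_split[OF Z, of c T p] FJ_split[OF sl_act_dom[OF Z det], of c T p]
      by (simp add: slash_inv_def algebra_simps)
  qed
qed

text \<open>Small translations rule out every \<open>m > 0\<close>. What remains is a constant
  multiple of an exponential in \<open>\<tau>'\<close>, and this cannot transform with positive
  weight.\<close>

lemma FJ_zero_of_translation:
  assumes lev: "level_inv N l M (FJ c T)" and M: "M > 0" and q: "q > 1" "coprime q M"
    and inv: "slash_inv N l (FJ c T) 1 (1 / of_int q) 0 1" and Z: "Z \<in> siegel_dom N"
  shows "FJ c T Z = 0"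
proof -
  define G where "G Z m = infsum (trm Z) {i\<in>cidx c T. fst i = m}" for Z m
  have G0: "G Z m = 0" if Z: "Z \<in> siegel_dom N" and m: "m > 0" for Z m
  proof -
    obtain x where x: "slash_inv N l (FJ c T) 1 x 0 1" "real m * x \<notin> \<int>"
      using fine_translations[OF lev q inv m] .
    obtain \<tau> z \<tau>' where Z_eq [simp]: "Z = (\<tau>, z, \<tau>')" by (cases Z)
    \<comment> \<open>Invariance under the translation by \<open>x\<close> holds at all shifted
      points, which isolates each exponent \<open>m\<close>; its part is multiplied by
      \<open>ee (m x) - 1\<close>, nonzero by the choice of \<open>x\<close>.\<close>
    have "((\<lambda>i. trm Z i * (ee (of_nat (fst i) * of_real x) - 1) * ee (of_nat (fst i) * t)) has_sum 0) (cidx c T)"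
      if t: "Im t \<ge> 0" for t
    proof -
      have Zt: "(\<tau> + t, z, \<tau>') \<in> siegel_dom N" using siegel_dom_shift1[OF _ t N_nonneg] Z by simp
      have Ztx: "(\<tau> + t + of_real x, z, \<tau>') \<in> siegel_dom N"
        using siegel_dom_shift1[OF Zt _ N_nonneg, of "of_real x"] by simp
      have "FJ c T (\<tau> + t + of_real x, z, \<tau>') = FJ c T (\<tau> + t, z, \<tau>')"
        using x(1) Zt unfolding slash_inv_def by (auto simp: sl_act_translation sl_act_one dest!: bspec[OF _ Zt])
      then have "((\<lambda>i. trm (\<tau> + t + of_real x, z, \<tau>') i - trm (\<tau> + t, z, \<tau>') i) has_sum 0) (cidx c T)"
        using has_sum_minus[OF FJ_has_sum[OF Ztx, of c T] FJ_has_sum[OF Zt, of c T]] by simp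
      then show ?thesis
        unfolding trm_shift1 by (simp add: left_diff_distrib right_diff_distrib mult_ac)
    qed
    from fiber_sum_zero[OF this, of m]
    have "infsum (\<lambda>i. trm Z i * (ee (of_nat (fst i) * of_real x) - 1)) {i\<in>cidx c T. fst i = m} = 0" .
    moreover have "infsum (\<lambda>i. trm Z i * (ee (of_nat (fst i) * of_real x) - 1)) {i\<in>cidx c T. fst i = m}
        = infsum (\<lambda>i. trm Z i * (ee (of_real (real m * x)) - 1)) {i\<in>cidx c T. fst i = m}"
      by (intro infsum_cong) auto
    ultimately have "G Z m * (ee (of_real (real m * x)) - 1) = 0"
      by (simp add: infsum_cmult_left' G_def)
    then show ?thesis using x(2) ee_of_real_eq_1[of "real m * x"] by simp
  qed
  have FG: "FJ c T Z = G Z 0" if Z: "Z \<in> siegel_dom N" for Z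
  proof -
    have "(G Z has_sum FJ c T Z) UNIV"
      unfolding G_def by (rule has_sum_fibers[OF FJ_has_sum[OF Z]])
    then have "infsum (G Z) UNIV = FJ c T Z" by (rule infsumI)
    moreover have "infsum (G Z) UNIV = infsum (G Z) {0}"
      by (rule infsum_cong_neutral) (use G0[OF Z] in auto)
    ultimately show ?thesis by simp
  qed
  obtain K where K: "\<And>Z. Z \<in> siegel_dom N \<Longrightarrow> FJ c T Z = K * ee (of_nat c * snd (snd Z))"
  proof (cases "0 \<in> T")
    case True
    \<comment> \<open>For \<open>m = 0\<close> the bound on \<open>r\<^sup>2\<close> leaves only
      \<open>r = 0\<close>.\<close>
    then have "{i\<in>cidx c T. fst i = 0} = {(0, 0, c)}" by (auto simp: cidx_def fidx_def)
    then have "FJ c T Z = B (0, 0, c) * ee (of_nat c * snd (snd Z))" if "Z \<in> siegel_dom N" for Z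
      using FG[OF that] by (simp add: G_def trm_def)
    then show ?thesis using that by blast
  next
    case False
    then have empty: "{i\<in>cidx c T. fst i = 0} = {}" unfolding cidx_def by fastforce
    then have "FJ c T Z = 0" if "Z \<in> siegel_dom N" for Z
      using FG[OF that] unfolding G_def empty by simp
    then show ?thesis using that[of 0] by simp
  qed
  \<comment> \<open>At \<open>z = 0\<close> the lower unipotent fixes \<open>\<tau>'\<close>, so the
    value does not change, while the automorphy factor \<open>M \<i> + 1\<close> has modulus greater
    than 1.\<close>
  have "(\<i>, 0, \<i>) \<in> siegel_dom N" by (simp add: siegel_dom_def)
  moreover have "slash_inv N l (FJ c T) 1 0 M 1"
    using level_invD[OF lev, of 1 1 0 M] by simp
  ultimately have "FJ c T (sl_act N 1 0 M 1 (\<i>, 0, \<i>)) = (of_int M * \<i> + 1) ^ l * FJ c T (\<i>, 0, \<i>)"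
    "sl_act N 1 0 M 1 (\<i>, 0, \<i>) \<in> siegel_dom N"
    using sl_act_dom[of "(\<i>, 0, \<i>)" N 1 1 0 M] by (auto simp: slash_inv_def aut_def dest!: bspec)
  then have "K * ee (of_nat c * \<i>) = (of_int M * \<i> + 1) ^ l * (K * ee (of_nat c * \<i>))"
    using K[of "(\<i>, 0, \<i>)"] K[of "sl_act N 1 0 M 1 (\<i>, 0, \<i>)"] \<open>(\<i>, 0, \<i>) \<in> siegel_dom N\<close>
    by (simp add: sl_act_def)
  moreover have "(of_int M * \<i> + 1) ^ l \<noteq> (1::complex)"
  proof
    assume "(of_int M * \<i> + 1) ^ l = (1::complex)"
    then have "cmod (of_int M * \<i> + 1) ^ l = 1" by (metis norm_power norm_one)
    moreover have "cmod (of_int M * \<i> + 1) > 1"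
      using M by (simp add: cmod_def real_less_rsqrt)
    ultimately show False using one_less_power[OF _ l, of "cmod (of_int M * \<i> + 1)"] by simp
  qed
  ultimately have "K = 0" by simp
  then show ?thesis using K[OF Z] by simp
qed

text \<open>Sieving by the primes dividing \<open>c\<close> goes upwards to control the levels
  (\<open>lev\<close>); vanishing is then carried back downwards, one prime at a time
  (\<open>down\<close>).\<close>

lemma FJ_zero:
  assumes c: "c > 0" and Z: "Z \<in> siegel_dom N"
  shows "FJ c UNIV Z = 0"
proof -
  define T where "T Q = {m::nat. \<forall>p\<in>Q. \<not> p dvd m}" for Q :: "nat set"
  have T_insert: "T (insert p Q) = {m \<in> T Q. \<not> p dvd m}" for p Q by (auto simp: T_def)
  have lev: "level_inv N l ((int (\<Prod>p\<in>Q. p))\<^sup>2) (FJ c (T Q))" if "finite Q" "\<forall>p\<in>Q. prime p" for Q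
    using that
  proof (induction Q)
    case empty
    show ?case using FJ_level_1 by (simp add: T_def)
  next
    case (insert p Q)
    then have "level_inv N l ((int (\<Prod>p\<in>Q. p))\<^sup>2 * (int p)\<^sup>2) (FJ c (T (insert p Q)))"
      unfolding T_insert by (intro FJ_level_not_dvd) (auto simp: prime_gt_0_nat)
    then show ?case using insert by (simp add: power_mult_distrib mult.commute)
  qed
  have down: "\<forall>Z\<in>siegel_dom N. FJ c UNIV Z = 0"
    if "finite Q" "\<forall>p\<in>Q. prime p" "\<forall>Z\<in>siegel_dom N. FJ c (T Q) Z = 0" for Q
    using that
  proof (induction Q)
    case empty
    then show ?case by (simp add: T_def)
  next
    case (insert p Q)
    have p: "prime p" using insert by simp
    \<comment> \<open>The terms with \<open>p\<close> not dividing \<open>m\<close> sum to zero by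
      assumption, so only multiples of \<open>p\<close> survive as exponents. This gives the
      translation by \<open>1 / p\<close>, while the level is a product over the other
      primes.\<close>
    have eq: "FJ c (T Q) Z = FJ c {m\<in>T Q. p dvd m} Z" if "Z \<in> siegel_dom N" for Z
      using FJ_split[OF that, of c "T Q" p] insert.prems(2) that by (simp add: T_insert)
    have "slash_inv N l (FJ c {m\<in>T Q. p dvd m}) 1 (1 / of_int (int p)) 0 1"
      using p by (intro FJ_translation_inv) (auto simp: prime_gt_0_nat elim!: dvdE)
    then have inv: "slash_inv N l (FJ c (T Q)) 1 (1 / of_int (int p)) 0 1"
      unfolding slash_inv_def using eq sl_act_dom[where N = N and a = 1 and d = 1 and c = 0] by simp
    have "coprime p q" if "q \<in> Q" for q
      using insert that by (intro primes_coprime) auto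
    then have "coprime p (\<Prod>p\<in>Q. p)" by (intro prod_coprime_right) auto
    then have "coprime (int p) (int (\<Prod>p\<in>Q. p))" unfolding coprime_int_iff .
    then have cop: "coprime (int p) ((int (\<Prod>p\<in>Q. p))\<^sup>2)" by (simp del: of_nat_prod)
    have "(\<Prod>p\<in>Q. p) > 0" using insert by (intro prod_pos) (auto simp: prime_gt_0_nat)
    then have "(int (\<Prod>p\<in>Q. p))\<^sup>2 > 0" by (simp only: zero_less_power of_nat_0_less_iff)
    moreover have "level_inv N l ((int (\<Prod>p\<in>Q. p))\<^sup>2) (FJ c (T Q))"
      using insert by (intro lev) auto
    moreover have "int p > 1" using prime_gt_1_nat[OF p] by simp
    ultimately have "\<forall>Z\<in>siegel_dom N. FJ c (T Q) Z = 0"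
      using FJ_zero_of_translation cop inv by blast
    then show ?case using insert by simp
  qed
  \<comment> \<open>Since \<open>c > 0\<close>, the remaining \<open>m\<close> are coprime to
    \<open>c\<close>, so each index is primitive whatever \<open>r\<close> is.\<close>
  have "FJ c (T (prime_factors c)) Z = 0" for Z
    unfolding FJ_def
  proof (rule infsum_0)
    fix i assume "i \<in> cidx c (T (prime_factors c))"
    then obtain m r where i: "i = (m, r, c)" and m: "m \<in> T (prime_factors c)" by (cases i) (auto simp: cidx_def)
    have "coprime m c"
    proof (rule ccontr)
      assume "\<not> coprime m c"
      then obtain p where "prime p" "p dvd gcd m c"
        using prime_factor_nat[of "gcd m c"] by (auto simp: coprime_iff_gcd_eq_1)
      then show False using m c by (auto simp: T_def prime_factors_dvd)
    qed
    then have "gcd (int m) (int c) = 1" by (simp add: coprime_iff_gcd_eq_1)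
    then have "gcd (int m) (gcd r (int c)) = 1"
      by (metis gcd.assoc gcd.commute gcd_1_int)
    then show "trm Z i = 0" by (simp add: i trm_def primitive_zero)
  qed
  then show ?thesis using down[of "prime_factors c"] Z by auto
qed

text \<open>Only \<open>c = 0\<close> remains. There \<open>r = 0\<close>, so the form depends on
  \<open>\<tau>\<close> alone, against its positive weight under the unipotent acting on
  \<open>\<tau>'\<close>.\<close>

theorem zero_of_primitive_zero:
  assumes Z: "Z \<in> siegel_dom N"
  shows "f Z = 0"
proof -
  have f0: "f Z = FJ 0 UNIV Z" if Z: "Z \<in> siegel_dom N" for Z
  proof -
    have "((\<lambda>c. FJ c UNIV Z) has_sum f Z) UNIV"
      using has_sum_fibers[OF trm_has_sum[OF Z], of "\<lambda>i. snd (snd i)"] by (simp add: FJ_def cidx_def)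
    then have "infsum (\<lambda>c. FJ c UNIV Z) UNIV = f Z" by (rule infsumI)
    moreover have "infsum (\<lambda>c. FJ c UNIV Z) UNIV = infsum (\<lambda>c. FJ c UNIV Z) {0}"
      by (rule infsum_cong_neutral) (use FJ_zero Z in auto)
    ultimately show ?thesis by simp
  qed
  have indep: "FJ 0 UNIV (\<tau>, z, \<tau>') = FJ 0 UNIV (\<tau>, u, \<upsilon>')" for \<tau> z \<tau>' u \<upsilon>'
    unfolding FJ_def by (intro infsum_cong) (auto simp: cidx_def fidx_def trm_def)
  obtain \<tau> z \<tau>' where [simp]: "Z = (\<tau>, z, \<tau>')" by (cases Z)
  have \<tau>: "Im \<tau> > 0" using Z by (simp add: siegel_dom_def)
  have im: "Im (\<i> / (\<i> + 1)) > 0" by (simp add: Im_divide power2_eq_square)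
  have d: "(\<tau>, 0, \<i>) \<in> siegel_dom N" "(\<tau>, 0, \<i> / (\<i> + 1)) \<in> siegel_dom N"
    using \<tau> im by (simp_all add: siegel_dom_def)
  \<comment> \<open>The two points differ only in \<open>\<tau>'\<close>, yet the transformation law
    relates their values by a power of \<open>\<i> + 1\<close>, whose modulus exceeds 1.\<close>
  have "f (\<tau>, 0, \<i> / (\<i> + 1)) = f (\<tau>, 0, \<i>)"
    using f0 d indep by metis
  then have "f (\<tau>, 0, \<i>) = (\<i> + 1) ^ l * f (\<tau>, 0, \<i>)"
    using opposite_inv[OF \<tau>, of \<i>] by simp
  moreover have "(\<i> + 1) ^ l \<noteq> (1::complex)"
  proof
    assume "(\<i> + 1) ^ l = (1::complex)"
    then have "cmod (\<i> + 1) ^ l = 1" by (metis norm_power norm_one)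
    moreover have "cmod (\<i> + 1) > 1" by (simp add: cmod_def)
    ultimately show False using one_less_power[OF _ l, of "cmod (\<i> + 1)"] by simp
  qed
  ultimately have "f (\<tau>, 0, \<i>) = 0" by simp
  moreover have "f Z = f (\<tau>, 0, \<i>)"
    using f0[OF Z] f0[OF d(1)] indep[of \<tau> z \<tau>' 0 \<i>] by simp
  ultimately show ?thesis by simp
qed

end

section \<open>Unipotent elements of the spin group\<close>

text \<open>The Eichler transvection of a totally isotropic pair: \<open>u\<close> and
  \<open>w\<close> anticommute and square to zero, so \<open>1 + u w\<close> has inverse
  \<open>1 + w u\<close>; moving \<open>v\<close> past \<open>w\<close> and \<open>u\<close> by the
  Clifford relations gives its action.\<close>

lemma clifford_sandwich:
  fixes u v w :: "real ^ vidx"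
  assumes "qf u = 0" "qf w = 0" "bf u w = 0"
  shows "(1 + cl_vec u * cl_vec w) * (1 + cl_vec w * cl_vec u) = 1"
    and "(1 + cl_vec w * cl_vec u) * (1 + cl_vec u * cl_vec w) = 1"
    and "(1 + cl_vec u * cl_vec w) * cl_vec v * (1 + cl_vec w * cl_vec u)
      = cl_vec (v + bf v w *\<^sub>R u - bf v u *\<^sub>R w)"
proof -
  define U where "U = cl_vec u"
  define W where "W = cl_vec w"
  define V where "V = cl_vec v"
  define s where "s = bf v u"
  define t where "t = bf v w"
  have UU: "U * U = 0" and WW: "W * W = 0"
    using assms by (simp_all add: U_def W_def cl_vec_square)
  have WU: "W * U = - (U * W)"
    using cl_vec_anticomm[of u w] assms(3) by (simp add: U_def W_def eq_neg_iff_add_eq_0 add.commute)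
  have VU: "V * U = s *\<^sub>R 1 - U * V"
    using cl_vec_anticomm[of v u] by (simp add: U_def V_def s_def algebra_simps)
  have VW: "V * W = t *\<^sub>R 1 - W * V"
    using cl_vec_anticomm[of v w] by (simp add: W_def V_def t_def algebra_simps)
  have "U * (W * U) = - (U * U * W)" by (simp add: WU mult.assoc)
  then have UWU: "U * (W * U) = 0" by (simp add: UU)
  have "U * W * (W * U) = U * (W * W) * U" by (simp only: mult.assoc)
  then have 1: "U * W * (W * U) = 0" by (simp add: WW)
  have "W * U * (U * W) = W * (U * U) * W" by (simp only: mult.assoc)
  then have 2: "W * U * (U * W) = 0" by (simp add: UU)
  have 3: "U * W + W * U = 0" by (simp add: WU)
  note 0 = 1 2 3
  have "(1 + U * W) * (1 + W * U) = 1 + (U * W + W * U) + U * W * (W * U)"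
    by (simp add: algebra_simps)
  then show "(1 + cl_vec u * cl_vec w) * (1 + cl_vec w * cl_vec u) = 1"
    by (simp only: 0 add_0_right flip: U_def W_def)
  have "(1 + W * U) * (1 + U * W) = 1 + (U * W + W * U) + W * U * (U * W)"
    by (simp add: algebra_simps)
  then show "(1 + cl_vec w * cl_vec u) * (1 + cl_vec u * cl_vec w) = 1"
    by (simp only: 0 add_0_right flip: U_def W_def)
  have VWU: "V * (W * U) = t *\<^sub>R U - s *\<^sub>R W - U * W * V"
  proof -
    have "V * (W * U) = V * W * U" by (simp only: mult.assoc)
    also have "\<dots> = t *\<^sub>R U - W * (V * U)"
      unfolding VW by (simp add: left_diff_distrib mult.assoc)
    also have "W * (V * U) = s *\<^sub>R W - W * U * V"
      unfolding VU by (simp add: right_diff_distrib mult.assoc)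
    finally show ?thesis by (simp add: WU)
  qed
  have "U * W * V * (W * U) = U * W * (V * (W * U))" by (simp only: mult.assoc)
  also have "\<dots> = t *\<^sub>R (U * (W * U)) - s *\<^sub>R (U * (W * W)) - U * (W * U) * (W * V)"
    unfolding VWU by (simp add: right_diff_distrib mult.assoc)
  finally have "U * W * V * (W * U) = 0" by (simp add: UWU WW)
  then have "(1 + U * W) * V * (1 + W * U) = V + t *\<^sub>R U - s *\<^sub>R W"
    by (simp add: distrib_left distrib_right VWU mult.assoc)
  also have "\<dots> = cl_vec (v + t *\<^sub>R u - s *\<^sub>R w)"
    using cl_vec_add[of "v + t *\<^sub>R u - s *\<^sub>R w" "s *\<^sub>R w"]
    by (simp add: cl_vec_add cl_vec_scaleR algebra_simps flip: U_def W_def V_def)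
  finally show "(1 + cl_vec u * cl_vec w) * cl_vec v * (1 + cl_vec w * cl_vec u)
      = cl_vec (v + bf v w *\<^sub>R u - bf v u *\<^sub>R w)"
    unfolding U_def W_def V_def s_def t_def .
qed

lemma bf_bvec: "bf v (bvec i) = v $ opp i"
  by (cases i) (simp_all add: bf_def bvec_def UNIV_vidx axis_def)

lemma bvec_nth: "bvec i $ k = (if k = i then 1 else 0)"
  by (simp add: bvec_def axis_def)

lemma opp_neq: "opp i \<noteq> i"
  by (cases i) simp_all

lemma opp_opp: "opp (opp i) = i"
  by (cases i) simp_all

text \<open>An Eichler transvection with \<open>w = - b_j\<close>. With this sign the pairs
  \<open>N2\<close>, \<open>P4\<close> and \<open>N2\<close>, \<open>N4\<close> get the automorphy
  factors \<open>\<tau> + 1\<close> and \<open>\<tau>' + 1\<close>.\<close>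

definition unip :: "vidx \<Rightarrow> vidx \<Rightarrow> clifford" where
  "unip i j = 1 - cl_vec (bvec i) * cl_vec (bvec j)"

definition unip_act :: "vidx \<Rightarrow> vidx \<Rightarrow> real ^ vidx \<Rightarrow> real ^ vidx" where
  "unip_act i j v = v - (v $ opp j) *\<^sub>R bvec i + (v $ opp i) *\<^sub>R bvec j"

lemma unip_sandwich:
  assumes ij: "j \<noteq> i" "j \<noteq> opp i"
  shows "unip i j * cl_rev (unip i j) = 1" "cl_rev (unip i j) * unip i j = 1"
    and "unip i j * cl_vec v * cl_rev (unip i j) = cl_vec (unip_act i j v)"
proof -
  have neg: "cl_vec (- bvec j) = - cl_vec (bvec j)"
    using cl_vec_scaleR[of "-1" "bvec j"] by simp
  have g: "unip i j = 1 + cl_vec (bvec i) * cl_vec (- bvec j)"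
    by (simp add: unip_def neg)
  have rev: "cl_rev (unip i j) = 1 + cl_vec (- bvec j) * cl_vec (bvec i)"
    by (simp add: g cl_rev_add cl_rev_mult cl_rev_one cl_rev_vec)
  have bfn: "bf v (- bvec j) = - (v $ opp j)" for v :: "real ^ vidx"
    by (cases j) (simp_all add: bf_def bvec_def UNIV_vidx axis_def)
  have *: "qf (bvec i :: real ^ vidx) = 0" "qf (- bvec j :: real ^ vidx) = 0"
    "bf (bvec i) (- bvec j :: real ^ vidx) = 0"
    using ij opp_neq[of i] opp_neq[of j] opp_opp[of j] by (auto simp: qf_def bf_bvec bfn bvec_nth)
  have "v + bf v (- bvec j) *\<^sub>R bvec i - bf v (bvec i) *\<^sub>R (- bvec j) = unip_act i j v"
    by (simp add: unip_act_def bfn bf_bvec)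
  then show "unip i j * cl_rev (unip i j) = 1" "cl_rev (unip i j) * unip i j = 1"
    "unip i j * cl_vec v * cl_rev (unip i j) = cl_vec (unip_act i j v)"
    using clifford_sandwich(1,2)[OF *] clifford_sandwich(3)[OF *, of v] unfolding rev by (simp_all add: g)
qed

lemma spin_act_unip:
  assumes "j \<noteq> i" "j \<noteq> opp i"
  shows "spin_act (unip i j) v = unip_act i j v"
  unfolding spin_act_def unip_sandwich(3)[OF assms]
  using inj_cl_vec by (auto simp: inj_eq)

text \<open>All coefficients of the element and of its inverse are 1 or -1, so one proof covers the
  rationals and all rings \<open>Z_local p\<close>.\<close>

lemma unip_spin_group:
  assumes ij: "j \<noteq> i" "j \<noteq> opp i" and I: "{i, j, opp i, opp j} \<subseteq> I"
    and R: "1 \<in> R" "\<And>x y. x \<in> R \<Longrightarrow> y \<in> R \<Longrightarrow> x - y \<in> R"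
  shows "unip i j \<in> spin_group I R"
proof -
  have R0: "0 \<in> R" using R(2)[OF R(1) R(1)] by simp
  have Rm: "- x \<in> R" if "x \<in> R" for x using R(2)[OF R0 that] by simp
  have Rp: "x + y \<in> R" if "x \<in> R" "y \<in> R" for x y using R(2)[OF that(1) Rm[OF that(2)]] by simp
  have "1 *\<^sub>R prod_list (map (\<lambda>i. cl_vec (bvec i)) []) + (- 1) *\<^sub>R prod_list (map (\<lambda>i. cl_vec (bvec i)) [i, j])
    \<in> even_clifford I R"
    using R(1) Rm[OF R(1)] I by (intro even_clifford.intros) auto
  then have even: "unip i j \<in> even_clifford I R" by (simp add: unip_def)
  have lat: "unip_act i j v \<in> vlattice I R" if "v \<in> vlattice I R" for v
    using that I R0 Rm Rp R by (auto simp: vlattice_def unip_act_def bvec_nth)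
  have surj: "v \<in> unip_act i j ` vlattice I R" if "v \<in> vlattice I R" for v
  proof
    \<comment> \<open>The image of \<open>v\<close> under the inverse transvection.\<close>
    define w where "w = v + (v $ opp j) *\<^sub>R bvec i - (v $ opp i) *\<^sub>R bvec j"
    show "w \<in> vlattice I R"
      using that I R0 Rm Rp R by (auto simp: vlattice_def w_def bvec_nth)
    have "w $ opp i = v $ opp i" "w $ opp j = v $ opp j"
      using ij opp_neq opp_opp by (auto simp: w_def bvec_nth)
    then show "v = unip_act i j w" by (simp add: unip_act_def w_def)
  qed
  have "(\<lambda>x. unip i j * x * cl_rev (unip i j)) ` cl_vec ` vlattice I R = cl_vec ` unip_act i j ` vlattice I R"
    by (simp add: image_image unip_sandwich(3)[OF ij])
  also have "unip_act i j ` vlattice I R = vlattice I R" using lat surj by blast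
  finally show ?thesis
    using even unip_sandwich(1,2)[OF ij] by (simp add: spin_group_def)
qed

lemma Z_local_diff:
  assumes "prime p" "x \<in> Z_local p" "y \<in> Z_local p"
  shows "x - y \<in> Z_local p"
proof -
  obtain a b c d :: int where x: "x = of_int a / of_int b" "\<not> int p dvd b"
    and y: "y = of_int c / of_int d" "\<not> int p dvd d"
    using assms by (auto simp: Z_local_def)
  have "b \<noteq> 0" "d \<noteq> 0" using x y by auto
  then have "x - y = of_int (a * d - c * b) / of_int (b * d)"
    by (simp add: x y divide_simps)
  moreover have "\<not> int p dvd b * d"
    using x(2) y(2) assms(1) by (simp add: prime_dvd_mult_iff)
  ultimately show ?thesis unfolding Z_local_def by blast
qed

lemma one_Z_local:
  assumes "prime p"
  shows "1 \<in> Z_local p"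
proof -
  have "(1::real) = of_int 1 / of_int 1" "\<not> int p dvd 1"
    using assms by (auto simp: prime_nat_iff)
  then show ?thesis unfolding Z_local_def by blast
qed

text \<open>The vector \<open>y\<close> lies in the span of \<open>b_3\<close> and
  \<open>b_{-3}\<close>, which is orthogonal to \<open>b_{-2}\<close>, \<open>b_4\<close> and
  \<open>b_{-4}\<close>; so it is fixed.\<close>

lemma unip_MprimeZ:
  assumes "j = P4 \<or> j = N4"
  shows "unip N2 j \<in> MprimeZ n \<alpha>"
proof -
  have ij: "j \<noteq> N2" "j \<noteq> opp N2" using assms by auto
  have "unip N2 j \<in> spin_group I33 \<rat>"
    using assms by (intro unip_spin_group) (auto simp: I33_def)
  moreover have "unip N2 j \<in> spin_group UNIV (Z_local p)" if "prime p" for p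
    using assms that by (intro unip_spin_group) (auto intro: Z_local_diff one_Z_local)
  moreover have "spin_act (unip N2 j) (y_vec n \<alpha>) = y_vec n \<alpha>"
    using assms by (auto simp: spin_act_unip[OF ij] unip_act_def y_vec_def bvec_nth)
  ultimately show ?thesis by (auto simp: MprimeZ_def Mprime_def)
qed

section \<open>Coordinates on the domain\<close>

text \<open>The coordinates of \<open>- \<tau>' b_4 + z y_dual - \<tau> b_{-4}\<close>; the entry at
  \<open>N3\<close> comes from \<open>y_dual\<close>.\<close>

definition dom_pt :: "nat \<Rightarrow> point \<Rightarrow> complex ^ vidx" where
  "dom_pt \<alpha> = (\<lambda>(\<tau>, z, \<tau>'). \<chi> i. case i of P4 \<Rightarrow> - \<tau>' | N4 \<Rightarrow> - \<tau> | P3 \<Rightarrow> z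
     | N3 \<Rightarrow> - of_real (real \<alpha> / 2) * z | _ \<Rightarrow> 0)"

lemma dom_pt_nth [simp]:
  "dom_pt \<alpha> (\<tau>, z, \<tau>') $ P1 = 0" "dom_pt \<alpha> (\<tau>, z, \<tau>') $ P2 = 0"
  "dom_pt \<alpha> (\<tau>, z, \<tau>') $ N1 = 0" "dom_pt \<alpha> (\<tau>, z, \<tau>') $ N2 = 0"
  "dom_pt \<alpha> (\<tau>, z, \<tau>') $ P3 = z" "dom_pt \<alpha> (\<tau>, z, \<tau>') $ N3 = - of_real (real \<alpha> / 2) * z"
  "dom_pt \<alpha> (\<tau>, z, \<tau>') $ P4 = - \<tau>'" "dom_pt \<alpha> (\<tau>, z, \<tau>') $ N4 = - \<tau>"
  by (simp_all add: dom_pt_def)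

lemma all_vidx: "(\<forall>i. P i) \<longleftrightarrow> P P1 \<and> P P2 \<and> P P3 \<and> P P4 \<and> P N1 \<and> P N2 \<and> P N3 \<and> P N4"
  by (metis vidx.exhaust)

lemma V12_iff:
  "v \<in> V12 \<alpha> \<longleftrightarrow> v $ P1 = 0 \<and> v $ P2 = 0 \<and> v $ N1 = 0 \<and> v $ N2 = 0 \<and> v $ N3 = - (real \<alpha> / 2) * v $ P3"
  (is "?L \<longleftrightarrow> ?R")
proof
  assume ?L
  then show ?R
    unfolding V12_def
  proof (induction rule: span_induct_alt)
    case (step c x y)
    from step(1) have "x $ P1 = 0 \<and> x $ P2 = 0 \<and> x $ N1 = 0 \<and> x $ N2 = 0 \<and> x $ N3 = - (real \<alpha> / 2) * x $ P3"
      by (elim insertE emptyE; hypsubst) (simp_all add: y_dual_def bvec_nth)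
    then show ?case using step.IH by (simp add: algebra_simps)
  qed simp
next
  assume ?R
  then have "v = v $ P4 *\<^sub>R bvec P4 + v $ P3 *\<^sub>R y_dual \<alpha> + v $ N4 *\<^sub>R bvec N4"
    by (auto simp: vec_eq_iff y_dual_def bvec_nth all_vidx)
  also have "\<dots> \<in> V12 \<alpha>"
    unfolding V12_def by (intro span_add span_mul span_base) auto
  finally show ?L .
qed


lemma mk_cvec_nth: "mk_cvec X Y $ i = of_real (X $ i) + \<i> * of_real (Y $ i)"
  by (simp add: mk_cvec_def cvec_def)

lemma bf_expand:
  "bf (v :: 'a::comm_ring_1 ^ vidx) w = v $ P1 * w $ N1 + v $ P2 * w $ N2 + v $ P3 * w $ N3 + v $ P4 * w $ N4
    + v $ N1 * w $ P1 + v $ N2 * w $ P2 + v $ N3 * w $ P3 + v $ N4 * w $ P4"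
  by (simp add: bf_def UNIV_vidx add_ac)

lemma dom_pt_mk_cvec:
  fixes \<tau> z \<tau>' :: complex and \<alpha> :: nat
  defines "X \<equiv> \<chi> i. Re (dom_pt \<alpha> (\<tau>, z, \<tau>') $ i)" and "Y \<equiv> \<chi> i. Im (dom_pt \<alpha> (\<tau>, z, \<tau>') $ i)"
  shows "dom_pt \<alpha> (\<tau>, z, \<tau>') = mk_cvec X Y" "X \<in> V12 \<alpha>" "Y \<in> V12 \<alpha>"
  by (simp_all add: X_def Y_def V12_iff vec_eq_iff mk_cvec_nth complex_eq)

lemma dom_pt_V12_complex: "dom_pt \<alpha> Z \<in> V12_complex \<alpha>"
proof -
  obtain \<tau> z \<tau>' where Z: "Z = (\<tau>, z, \<tau>')" by (cases Z)
  show ?thesis unfolding V12_complex_def Z using dom_pt_mk_cvec[of \<alpha> \<tau> z \<tau>'] by blast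
qed

lemma bf_v2: "bf Y (- sqrt 2 *\<^sub>R v2) = - (Y $ P4 + Y $ N4)"
  by (simp add: bf_expand v2_def bvec_nth algebra_simps)

lemma dom_pt_hdom:
  assumes "Z \<in> siegel_dom (real \<alpha> / 2)"
  shows "dom_pt \<alpha> Z \<in> hdom \<alpha>"
proof -
  obtain \<tau> z \<tau>' where [simp]: "Z = (\<tau>, z, \<tau>')" by (cases Z)
  let ?Y = "\<chi> i. Im (dom_pt \<alpha> (\<tau>, z, \<tau>') $ i)"
  have *: "Im \<tau> > 0" "Im \<tau> * Im \<tau>' > real \<alpha> / 2 * (Im z)\<^sup>2" using assms by (auto simp: siegel_dom_def)
  have "0 \<le> real \<alpha> / 2 * (Im z)\<^sup>2" by simp
  then have "0 < Im \<tau> * Im \<tau>'" using * by linarith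
  then have "0 < Im \<tau>'" using * by (simp add: zero_less_mult_iff)
  moreover have "bf ?Y ?Y > 0" using * by (simp add: bf_expand power2_eq_square algebra_simps)
  ultimately show ?thesis
    using dom_pt_mk_cvec[of \<alpha> \<tau> z \<tau>'] * unfolding hdom_def bf_v2 by fastforce
qed

lemma hdom_dom_pt:
  assumes "Q \<in> hdom \<alpha>"
  obtains Z where "Z \<in> siegel_dom (real \<alpha> / 2)" "Q = dom_pt \<alpha> Z"
proof -
  obtain X Y where Q: "Q = mk_cvec X Y" and V: "X \<in> V12 \<alpha>" "Y \<in> V12 \<alpha>"
    and pos: "bf Y (- sqrt 2 *\<^sub>R v2) > 0" "bf Y Y > 0"
    using assms by (auto simp: hdom_def)
  have "Q = dom_pt \<alpha> (- Q $ N4, Q $ P3, - Q $ P4)"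
    using V by (simp add: vec_eq_iff all_vidx Q mk_cvec_nth V12_iff algebra_simps)
  moreover have "(- Q $ N4, Q $ P3, - Q $ P4) \<in> siegel_dom (real \<alpha> / 2)"
  proof -
    have 1: "Y $ N4 * Y $ P4 > real \<alpha> / 2 * (Y $ P3)\<^sup>2" and 2: "Y $ P4 + Y $ N4 < 0"
      using pos V by (simp_all only: bf_v2) (simp_all add: bf_expand V12_iff power2_eq_square algebra_simps)
    have "0 \<le> real \<alpha> / 2 * (Y $ P3)\<^sup>2" by simp
    then have "0 < Y $ N4 * Y $ P4" using 1 by linarith
    then have "Y $ N4 < 0" using 2 by (auto simp: zero_less_mult_iff)
    then show ?thesis using 1 by (simp add: siegel_dom_def Q mk_cvec_nth)
  qed
  ultimately show thesis using that by blast
qed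

section \<open>The dual lattice, its cone and its primitive vectors\<close>

definition dual_vec :: "nat \<Rightarrow> nat \<times> int \<times> nat \<Rightarrow> real ^ vidx" where
  "dual_vec \<alpha> = (\<lambda>(m, r, c). of_int (- int m) *\<^sub>R bvec P4 + of_int (- r) *\<^sub>R ((1 / real \<alpha>) *\<^sub>R y_dual \<alpha>)
     + of_int (- int c) *\<^sub>R bvec N4)"

lemma bf_dual_vec_dom_pt:
  assumes "\<alpha> > 0"
  shows "bf (cvec (dual_vec \<alpha> (m, r, c))) (dom_pt \<alpha> (\<tau>, z, \<tau>')) = of_nat m * \<tau> + of_int r * z + of_nat c * \<tau>'"
  using assms by (simp add: bf_expand cvec_def dual_vec_def y_dual_def bvec_nth field_simps)

lemma dual_comb_nth:
  assumes "\<alpha> > 0"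
  defines "S a b c \<equiv> of_int a *\<^sub>R bvec P4 + of_int b *\<^sub>R ((1 / real \<alpha>) *\<^sub>R y_dual \<alpha>) + of_int c *\<^sub>R (bvec N4 :: real ^ vidx)"
  shows "S a b c $ P4 = of_int a" "S a b c $ P3 = of_int b / real \<alpha>" "S a b c $ N4 = of_int c"
    "S a b c $ N3 = - of_int b / 2" "bf (S a b c) (S a b c) = of_int (2 * a * c) - of_int (b\<^sup>2) / real \<alpha>"
  using assms(1) by (simp_all add: S_def bf_expand y_dual_def bvec_nth power2_eq_square field_simps)

lemma dual_vec_nth:
  assumes "\<alpha> > 0"
  shows "dual_vec \<alpha> (m, r, c) $ P4 = - real m" "dual_vec \<alpha> (m, r, c) $ P3 = - (of_int r / real \<alpha>)"
    "dual_vec \<alpha> (m, r, c) $ N4 = - real c"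
  unfolding dual_vec_def prod.case dual_comb_nth[OF assms] by simp_all

text \<open>The condition \<open>(S, S) \<ge> 0\<close> reads
  \<open>r\<^sup>2 \<le> 2 \<alpha> m c\<close>. So the coordinates at \<open>P4\<close> and
  \<open>N4\<close> have nonnegative product, and the pairing with \<open>v2\<close> makes both
  nonpositive, hence the signs in \<open>dual_vec\<close>.\<close>

lemma bij_betw_dual_vec:
  assumes "\<alpha> > 0"
  shows "bij_betw (dual_vec \<alpha>) (fidx \<alpha>) (V12_dual_nonneg \<alpha>)"
  unfolding bij_betw_def
proof
  note nth = dual_comb_nth[OF assms]
  show "inj_on (dual_vec \<alpha>) (fidx \<alpha>)"
  proof (rule inj_onI)
    fix x y assume eq: "dual_vec \<alpha> x = dual_vec \<alpha> y"
    obtain m r c m' r' c' where [simp]: "x = (m, r, c)" "y = (m', r', c')" by (cases x, cases y)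
    have "dual_vec \<alpha> x $ i = dual_vec \<alpha> y $ i" for i using eq by simp
    from this[of P4] this[of P3] this[of N4] show "x = y"
      using assms by (simp add: dual_vec_nth[OF assms])
  qed
  show "dual_vec \<alpha> ` fidx \<alpha> = V12_dual_nonneg \<alpha>"
  proof (intro equalityI subsetI)
    fix S assume "S \<in> dual_vec \<alpha> ` fidx \<alpha>"
    then obtain m r c where S: "S = dual_vec \<alpha> (m, r, c)" and le: "r\<^sup>2 \<le> 2 * int \<alpha> * int m * int c"
      by (auto simp: fidx_def)
    have "real_of_int (r\<^sup>2) \<le> of_int (2 * int \<alpha> * int m * int c)" using le by (rule of_int_le_iff[THEN iffD2])
    then have "bf S S \<ge> 0" unfolding S dual_vec_def prod.case nth using assms by (simp add: field_simps)
    moreover have "bf S (- sqrt 2 *\<^sub>R v2) \<ge> 0"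
      unfolding bf_v2 S dual_vec_def prod.case nth by simp
    moreover have "S \<in> V12_dual \<alpha>" unfolding S dual_vec_def prod.case V12_dual_def by blast
    ultimately show "S \<in> V12_dual_nonneg \<alpha>" by (simp add: V12_dual_nonneg_def)
  next
    fix S assume S: "S \<in> V12_dual_nonneg \<alpha>"
    then obtain a b c :: int where S_eq: "S = of_int a *\<^sub>R bvec P4 + of_int b *\<^sub>R ((1 / real \<alpha>) *\<^sub>R y_dual \<alpha>)
      + of_int c *\<^sub>R bvec N4" by (auto simp: V12_dual_nonneg_def V12_dual_def)
    have "bf S S \<ge> 0" "bf S (- sqrt 2 *\<^sub>R v2) \<ge> 0" using S by (auto simp: V12_dual_nonneg_def)
    then have "of_int (b\<^sup>2) \<le> real_of_int (2 * int \<alpha> * a * c)" and ac: "a + c \<le> 0"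
      unfolding S_eq bf_v2 nth using assms by (simp_all add: field_simps)
    then have le: "b\<^sup>2 \<le> 2 * int \<alpha> * a * c" by (simp only: of_int_le_iff)
    then have "0 \<le> 2 * int \<alpha> * a * c" using zero_le_power2[of b] by linarith
    then have "0 \<le> (2 * int \<alpha>) * (a * c)" by (simp only: mult.assoc)
    then have "0 \<le> a * c" using assms by (simp add: zero_le_mult_iff)
    then have neg: "a \<le> 0" "c \<le> 0" using ac by (auto simp: zero_le_mult_iff)
    then have "S = dual_vec \<alpha> (nat (- a), - b, nat (- c))" by (simp add: dual_vec_def S_eq)
    moreover have "(nat (- a), - b, nat (- c)) \<in> fidx \<alpha>" using neg le by (simp add: fidx_def)
    ultimately show "S \<in> dual_vec \<alpha> ` fidx \<alpha>" by blast
  qed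
qed

text \<open>Bezout: if \<open>t\<close> times each of \<open>m\<close>, \<open>r\<close>,
  \<open>c\<close> is an integer and these have gcd 1, then \<open>t\<close> is an integer. This
  turns the gcd condition into the lattice condition of the hypothesis.\<close>

lemma dual_vec_primitive:
  assumes \<alpha>: "\<alpha> > 0" and gcd: "gcd (int m) (gcd r (int c)) = 1"
  shows "{t *\<^sub>R dual_vec \<alpha> (m, r, c) | t. t \<in> \<rat>} \<inter> V12_dual \<alpha> = {t *\<^sub>R dual_vec \<alpha> (m, r, c) | t. t \<in> \<int>}"
proof (intro equalityI subsetI)
  note nth = dual_comb_nth[OF \<alpha>]
  fix S assume "S \<in> {t *\<^sub>R dual_vec \<alpha> (m, r, c) | t. t \<in> \<rat>} \<inter> V12_dual \<alpha>"
  then obtain t a b d where S: "S = t *\<^sub>R dual_vec \<alpha> (m, r, c)"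
    and S': "S = of_int a *\<^sub>R bvec P4 + of_int b *\<^sub>R ((1 / real \<alpha>) *\<^sub>R y_dual \<alpha>) + of_int d *\<^sub>R bvec N4"
    by (auto simp: V12_dual_def)
  have "S $ i = t * dual_vec \<alpha> (m, r, c) $ i" for i by (simp add: S)
  from this[of P4] this[of P3] this[of N4]
  have *: "t * of_nat m = - of_int a" "t * of_int r = - of_int b" "t * of_nat c = - of_int d"
    using \<alpha> unfolding S' nth dual_vec_nth[OF \<alpha>] by (simp_all add: field_simps)
  obtain x y where xy: "x * int m + y * gcd r (int c) = 1"
    using bezout_int[of "int m" "gcd r (int c)"] gcd by auto
  obtain u v where uv: "u * r + v * int c = gcd r (int c)"
    using bezout_int[of r "int c"] by auto
  have "x * int m + y * (u * r + v * int c) = 1" using xy uv by simp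
  then have "real_of_int (x * int m + y * (u * r + v * int c)) = 1" by simp
  then have "t = t * (x * real m + y * (u * r + v * real c))" by simp
  also have "\<dots> = x * (t * real m) + y * (u * (t * r) + v * (t * real c))" by (simp add: algebra_simps)
  also have "\<dots> = of_int (- x * a - y * (u * b + v * d))" unfolding * by (simp add: algebra_simps)
  finally have "t \<in> \<int>" by (metis Ints_of_int)
  then show "S \<in> {t *\<^sub>R dual_vec \<alpha> (m, r, c) | t. t \<in> \<int>}" using S by blast
next
  fix S assume "S \<in> {t *\<^sub>R dual_vec \<alpha> (m, r, c) | t. t \<in> \<int>}"
  then obtain k :: int where S: "S = of_int k *\<^sub>R dual_vec \<alpha> (m, r, c)" by (auto elim: Ints_cases)
  have "S = of_int (k * (- int m)) *\<^sub>R bvec P4 + of_int (k * (- r)) *\<^sub>R ((1 / real \<alpha>) *\<^sub>R y_dual \<alpha>)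
     + of_int (k * (- int c)) *\<^sub>R bvec N4"
    unfolding S dual_vec_def prod.case of_int_mult by (simp only: scaleR_add_right scaleR_scaleR mult.assoc)
  then have "S \<in> V12_dual \<alpha>" unfolding V12_dual_def by blast
  then show "S \<in> {t *\<^sub>R dual_vec \<alpha> (m, r, c) | t. t \<in> \<rat>} \<inter> V12_dual \<alpha>"
    using S Rats_of_int by blast
qed

section \<open>The action of the two unipotents in coordinates\<close>

lemma qf_dom_pt: "qf (dom_pt \<alpha> (\<tau>, z, \<tau>')) = \<tau> * \<tau>' - of_real (real \<alpha> / 2) * z\<^sup>2"
  by (simp add: qf_expand power2_eq_square algebra_simps)

lemma r_vec_nth:
  "r_vec Z $ i = Z $ i + (if i = P2 then - qf Z else 0) + (if i = N2 then 1 else 0)"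
  by (auto simp: r_vec_def bvec_nth)

text \<open>Uniqueness in the definite description: vectors in \<open>V12_complex \<alpha>\<close>
  vanish at \<open>P2\<close> and \<open>N2\<close>, so \<open>r_vec\<close> is injective there, and
  the nonzero automorphy factor cancels.\<close>

lemma dom_act_eqI:
  assumes Q: "Q \<in> V12_complex \<alpha>" and eq: "spin_act_c g (r_vec Z) = j_fac g Z *s r_vec Q" and j: "j_fac g Z \<noteq> 0"
  shows "dom_act \<alpha> g Z = Q"
  unfolding dom_act_def
proof (rule the_equality)
  fix Q' assume Q': "Q' \<in> V12_complex \<alpha> \<and> spin_act_c g (r_vec Z) = j_fac g Z *s r_vec Q'"
  then have "r_vec Q' = r_vec Q" using eq j by (simp add: vec_eq_iff)
  then have r: "r_vec Q' $ i = r_vec Q $ i" for i by simp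
  have 0: "V $ P2 = 0" "V $ N2 = 0" if "V \<in> V12_complex \<alpha>" for V
    using that by (auto simp: V12_complex_def mk_cvec_nth V12_iff)
  have "Q' $ i = Q $ i" for i
  proof (cases "i = P2 \<or> i = N2")
    case True
    then show ?thesis using 0 Q Q' by auto
  next
    case False
    then show ?thesis using r[of i] by (simp add: r_vec_nth)
  qed
  then show "Q' = Q" by (simp add: vec_eq_iff)
qed (use Q eq in blast)

lemma spin_act_c_unip:
  assumes "j \<noteq> i" "j \<noteq> opp i"
  shows "spin_act_c (unip i j) Z $ k = Z $ k - (if k = i then Z $ opp j else 0) + (if k = j then Z $ opp i else 0)"
  by (simp add: spin_act_c_def spin_act_unip[OF assms] mk_cvec_nth unip_act_def bvec_nth complex_eq_iff)

lemma j_fac_unip: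
  "j_fac (unip N2 P4) (dom_pt \<alpha> (\<tau>, z, \<tau>')) = \<tau> + 1"
  "j_fac (unip N2 N4) (dom_pt \<alpha> (\<tau>, z, \<tau>')) = \<tau>' + 1"
  by (simp_all add: j_fac_def bf_bvec spin_act_c_unip r_vec_nth)

text \<open>This identifies \<open>unip N2 P4\<close> with the lower unipotent of entry 1 under
  \<open>sl_act\<close> for \<open>N = \<alpha> / 2\<close>.\<close>

lemma dom_act_unip_P4:
  assumes "\<tau> + 1 \<noteq> 0"
  shows "dom_act \<alpha> (unip N2 P4) (dom_pt \<alpha> (\<tau>, z, \<tau>'))
    = dom_pt \<alpha> (\<tau> / (\<tau> + 1), z / (\<tau> + 1), \<tau>' - of_real (real \<alpha> / 2) * z\<^sup>2 / (\<tau> + 1))"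
    (is "_ = dom_pt \<alpha> ?Z'")
proof (intro dom_act_eqI dom_pt_V12_complex)
  define j where "j = \<tau> + 1"
  define a where "a = complex_of_real (real \<alpha> / 2)"
  have j: "j \<noteq> 0" using assms by (simp add: j_def)
  then show "j_fac (unip N2 P4) (dom_pt \<alpha> (\<tau>, z, \<tau>')) \<noteq> 0" by (simp add: j_fac_unip j_def)
  \<comment> \<open>Two coordinates involve the quadratic form. At \<open>P2\<close> the claim is
    that \<open>j\<close> times the form of the image is the form of the original point; at
    \<open>P4\<close> it is the identity \<open>t\<close>.\<close>
  have "j * (\<tau> / j * (\<tau>' - a * z\<^sup>2 / j) - a * (z / j)\<^sup>2) = \<tau> * \<tau>' - (\<tau> + 1) * (a * z\<^sup>2 / j)"
    using j by (simp add: power_divide algebra_simps) (simp add: power2_eq_square add_divide_distrib)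
  also have "\<dots> = \<tau> * \<tau>' - a * z\<^sup>2" using j by (simp add: j_def[symmetric])
  finally have q: "j * (\<tau> / j * (\<tau>' - a * z\<^sup>2 / j) - a * (z / j)\<^sup>2) = \<tau> * \<tau>' - a * z\<^sup>2" .
  have t: "j * (\<tau>' - a * z\<^sup>2 / j) = \<tau>' + (\<tau> * \<tau>' - a * z\<^sup>2)"
    using j by (simp add: right_diff_distrib) (simp add: j_def algebra_simps)
  have q': "a * z\<^sup>2 - \<tau> * \<tau>' = j * (a * (z / j)\<^sup>2 - \<tau> / j * (\<tau>' - a * z\<^sup>2 / j))"
    using arg_cong[OF q, of uminus] by (simp only: mult_minus_right[symmetric] minus_diff_eq)
  have t': "a * z\<^sup>2 - \<tau> * \<tau>' - \<tau>' = j * (a * z\<^sup>2 / j - \<tau>')"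
    using arg_cong[OF t, of uminus] by (simp only: mult_minus_right[symmetric] minus_diff_eq) simp
  have qf: "qf (dom_pt \<alpha> (\<tau>, z, \<tau>')) = \<tau> * \<tau>' - a * z\<^sup>2"
    "qf (dom_pt \<alpha> (\<tau> / j, z / j, \<tau>' - a * z\<^sup>2 / j)) = \<tau> / j * (\<tau>' - a * z\<^sup>2 / j) - a * (z / j)\<^sup>2"
    by (simp_all only: qf_dom_pt a_def)
  show "spin_act_c (unip N2 P4) (r_vec (dom_pt \<alpha> (\<tau>, z, \<tau>'))) = j_fac (unip N2 P4) (dom_pt \<alpha> (\<tau>, z, \<tau>')) *s r_vec (dom_pt \<alpha> ?Z')"
    unfolding j_fac_unip vec_eq_iff all_vidx j_def[symmetric] a_def[symmetric]
  proof (intro conjI)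
    let ?g = "spin_act_c (unip N2 P4) (r_vec (dom_pt \<alpha> (\<tau>, z, \<tau>')))"
    let ?r = "r_vec (dom_pt \<alpha> (\<tau> / j, z / j, \<tau>' - a * z\<^sup>2 / j))"
    show "?g $ P2 = (j *s ?r) $ P2" using q' by (simp add: spin_act_c_unip r_vec_nth qf)
    show "?g $ P4 = (j *s ?r) $ P4" using t' by (simp add: spin_act_c_unip r_vec_nth qf)
    show "?g $ N2 = (j *s ?r) $ N2" by (simp add: spin_act_c_unip r_vec_nth j_def)
  qed (use j in \<open>simp_all add: spin_act_c_unip r_vec_nth\<close>)
qed

text \<open>At \<open>z = 0\<close> this element moves \<open>\<tau>'\<close> alone, which suffices
  for the term \<open>c = 0\<close>.\<close>

lemma dom_act_unip_N4:
  assumes "\<tau>' + 1 \<noteq> 0"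
  shows "dom_act \<alpha> (unip N2 N4) (dom_pt \<alpha> (\<tau>, 0, \<tau>')) = dom_pt \<alpha> (\<tau>, 0, \<tau>' / (\<tau>' + 1))"
proof (intro dom_act_eqI dom_pt_V12_complex)
  define j where "j = \<tau>' + 1"
  have j: "j \<noteq> 0" using assms by (simp add: j_def)
  then show "j_fac (unip N2 N4) (dom_pt \<alpha> (\<tau>, 0, \<tau>')) \<noteq> 0" by (simp add: j_fac_unip j_def)
  show "spin_act_c (unip N2 N4) (r_vec (dom_pt \<alpha> (\<tau>, 0, \<tau>'))) = j_fac (unip N2 N4) (dom_pt \<alpha> (\<tau>, 0, \<tau>')) *s r_vec (dom_pt \<alpha> (\<tau>, 0, \<tau>' / (\<tau>' + 1)))"
    unfolding j_fac_unip vec_eq_iff all_vidx j_def[symmetric]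
    using j by (simp add: spin_act_c_unip r_vec_nth qf_dom_pt) (simp add: j_def algebra_simps)
qed

theorem theorem4p5:
  fixes n \<alpha> l :: nat
    and f :: "complex ^ vidx \<Rightarrow> complex"
    and A :: "real ^ vidx \<Rightarrow> complex"
  assumes "n \<ge> 1"
    and "\<alpha> > 0" and "even \<alpha>"
    and "l > 0"
    and "holo_modular_form n \<alpha> l (MprimeZ n \<alpha>) f"
    and "fourier_expansion \<alpha> f A"
    and "\<forall>S\<in>V12_dual \<alpha>.
           {t *\<^sub>R S | t. t \<in> \<rat>} \<inter> V12_dual \<alpha> = {t *\<^sub>R S | t. t \<in> \<int>} \<longrightarrow> A S = 0"
  shows "\<forall>Z\<in>hdom \<alpha>. f Z = 0"
proof -
  have mod: "f (dom_act \<alpha> \<gamma> Z) = j_fac \<gamma> Z ^ l * f Z" if "\<gamma> \<in> MprimeZ n \<alpha>" "Z \<in> hdom \<alpha>" for \<gamma> Z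
    using assms(5) that by (simp add: holo_modular_form_def)
  \<comment> \<open>The expansion is reindexed along \<open>dual_vec\<close>, the two invariances
    come from unipotents in \<open>MprimeZ\<close>, and the vanishing coefficients from
    \<open>dual_vec_primitive\<close>.\<close>
  interpret fourier_form \<alpha> l "\<lambda>i. A (dual_vec \<alpha> i)" "\<lambda>Z. f (dom_pt \<alpha> Z)" "real \<alpha> / 2"
  proof (unfold_locales)
    show "l > 0" by fact
  next
    fix Z assume Z: "Z \<in> siegel_dom (real \<alpha> / 2)"
    obtain \<tau> z \<tau>' where [simp]: "Z = (\<tau>, z, \<tau>')" by (cases Z)
    have "((\<lambda>S. A S * exp (2 * of_real pi * \<i> * bf (cvec S) (dom_pt \<alpha> Z))) has_sum f (dom_pt \<alpha> Z))
        (V12_dual_nonneg \<alpha>)"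
      using assms(6) dom_pt_hdom[OF Z] by (simp add: fourier_expansion_def)
    then have "((\<lambda>i. A (dual_vec \<alpha> i) * exp (2 * of_real pi * \<i> * bf (cvec (dual_vec \<alpha> i)) (dom_pt \<alpha> Z)))
        has_sum f (dom_pt \<alpha> Z)) (fidx \<alpha>)"
      by (subst has_sum_reindex_bij_betw[OF bij_betw_dual_vec[OF assms(2)]])
    moreover have "(\<lambda>i. A (dual_vec \<alpha> i) * exp (2 * of_real pi * \<i> * bf (cvec (dual_vec \<alpha> i)) (dom_pt \<alpha> Z)))
      = (\<lambda>(m, r, c). A (dual_vec \<alpha> (m, r, c)) * ee (of_nat m * fst Z + of_int r * fst (snd Z) + of_nat c * snd (snd Z)))"
      by (auto simp: fun_eq_iff bf_dual_vec_dom_pt[OF assms(2)] ee_def)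
    ultimately show "((\<lambda>(m, r, c). A (dual_vec \<alpha> (m, r, c)) * ee (of_nat m * fst Z + of_int r * fst (snd Z)
        + of_nat c * snd (snd Z))) has_sum f (dom_pt \<alpha> Z)) (fidx \<alpha>)" by simp
  next
    show "slash_inv (real \<alpha> / 2) l (\<lambda>Z. f (dom_pt \<alpha> Z)) 1 0 1 1"
      unfolding slash_inv_def
    proof (intro conjI ballI)
      fix Z assume Z: "Z \<in> siegel_dom (real \<alpha> / 2)"
      obtain \<tau> z \<tau>' where [simp]: "Z = (\<tau>, z, \<tau>')" by (cases Z)
      have "\<tau> + 1 \<noteq> 0" using aut_nonzero[OF Z, of 1 1 0 1] by (simp add: aut_def)
      then show "f (dom_pt \<alpha> (sl_act (real \<alpha> / 2) 1 0 1 1 Z)) = aut 1 1 Z ^ l * f (dom_pt \<alpha> Z)"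
        using mod[OF unip_MprimeZ dom_pt_hdom[OF Z], of P4]
        by (simp add: dom_act_unip_P4 j_fac_unip sl_act_def aut_def)
    qed simp
  next
    fix \<tau> \<tau>' :: complex assume \<tau>: "Im \<tau> > 0" "Im \<tau>' > 0"
    then have "(\<tau>, 0, \<tau>') \<in> siegel_dom (real \<alpha> / 2)" by (simp add: siegel_dom_def)
    moreover have "\<tau>' + 1 \<noteq> 0" using \<tau>(2) by (auto simp: complex_eq_iff)
    ultimately show "f (dom_pt \<alpha> (\<tau>, 0, \<tau>' / (\<tau>' + 1))) = (\<tau>' + 1) ^ l * f (dom_pt \<alpha> (\<tau>, 0, \<tau>'))"
      using mod[OF unip_MprimeZ dom_pt_hdom, of N4 "(\<tau>, 0, \<tau>')"] by (simp add: dom_act_unip_N4 j_fac_unip)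
  next
    fix m c :: nat and r :: int assume gcd: "gcd (int m) (gcd r (int c)) = 1"
    have mem: "dual_vec \<alpha> (m, r, c) \<in> V12_dual \<alpha>"
      unfolding dual_vec_def prod.case V12_dual_def by blast
    show "A (dual_vec \<alpha> (m, r, c)) = 0"
      by (rule assms(7)[rule_format, OF mem dual_vec_primitive[OF assms(2) gcd]])
  qed
  show ?thesis
  proof
    fix Q assume "Q \<in> hdom \<alpha>"
    then obtain Z where "Z \<in> siegel_dom (real \<alpha> / 2)" "Q = dom_pt \<alpha> Z" by (rule hdom_dom_pt)
    then show "f Q = 0" using zero_of_primitive_zero by simp
  qed
qed

end
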